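(* Consider the second-order system $$\dot{x}_1=x_2,\qquad \dot{x}_2=f(x_1,x_2,u,t)+gu,\qquad y=x_1,$$ where $g$ and $f$ satisfy the following assumption: $g$ is a known nonzero real constant; $f$ is unknown with a bounded rate, i.e., there exists $\varphi>0$ such that $|\dot{f}(x_1,x_2,u,t)|\leq\varphi$ for all $x_1,x_2,u\in\mathbb{R}$ and $t\in[0,\infty)$; and for any $\sigma>0$ there exists $\delta_f>0$ such that if $|x_1|+|x_2|<\sigma$, then $|f(x_1,x_2,u,t)|<\delta_f$ for all $t\in[0,\infty)$ and $u\in\mathbb{R}$. Let $0<\varepsilon<1$, and let $\alpha_1,\alpha_2,\alpha_3$ be such that the matrix $$E=\begin{bmatrix}-\alpha_1&1&0\\-\alpha_2&0&1\\-\alpha_3&0&0\end{bmatrix}$$ is Hurwitz. Let the system be controlled by the S-ADRC scheme consisting of the linear extended state observer $$\dot{\hat{x}}_1=\hat{x}_2+\frac{\alpha_1}{\varepsilon}(y-\hat{x}_1),\qquad \dot{\hat{x}}_2=\hat{x}_3+\frac{\alpha_2}{\varepsilon^2}(y-\hat{x}_1)+gu,\qquad \dot{\hat{x}}_3=\frac{\alpha_3}{\varepsilon^3}(y-\hat{x}_1),$$ with state $\hat{x}=[\hat{x}_1,\hat{x}_2,\hat{x}_3]^\top$, and the controller $$u=-\frac{1}{g}\bigl(p\hat{x}_1+d(\hat{x})\hat{x}_2+\hat{x}_3\bigr),\qquad d(\hat{x})=\min\left\{\delta,\sqrt{\left(\frac{\hat{x}_3-\rho\hat{x}_1}{\hat{x}_2}\right)^2+\beta}\right\},$$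 where $p>0$, $\delta>0$, $\rho$, $\beta$ are constants with $0<\rho<p$ and $2(p+\rho)<\beta$. Then the closed-loop system satisfies the following attractivity and boundedness properties for any bounded initial conditions $\hat{x}(0)$ and $x(0)$: 1. There exists $\sigma>0$ such that $\|x(t)\|<\sigma$ for all $t\geq 0$. 2. $x\rightarrow 0$ as $\varepsilon\rightarrow 0$ and $t\rightarrow\infty$. 3. There exists $t_0\geq 0$ such that $\|x-\hat{x}\|=\mathrm{O}(\varepsilon)$ for all $t\geq t_0$.
   Context: Here $x_1,x_2\in\mathbb{R}$ are the state variables, $y\in\mathbb{R}$ is the output, and the control input $u\in\mathcal{C}^1$ (a $1$-times differentiable function) depends on $y$ through the observer. The extended state variable is $x_3=f(x_1,x_2,u,t)$; $\hat{x}$ estimates $x=[x_1,x_2,x_3]^\top$, so $x-\hat{x}$ has components $x_i-\hat{x}_i$, $i=1,2,3$. In property 2, $x$ refers to the system state $(x_1,x_2)$. The dot on $f$ denotes its time derivative along the system. $\|\cdot\|$ is the 2-norm and $|\cdot|$ the absolute value. A vector-valued function $v$ is in the order of $\varepsilon$, written $\|v\|=\mathrm{O}(\varepsilon)$, when there exists a real constant $\sigma>0$ such that $\|v\|\leq\sigma\varepsilon$. A matrix is Hurwitz if all its eigenvalues have negative real part. *)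

theory Defs
  imports "HOL-Analysis.Analysis" "Jordan_Normal_Form.Char_Poly"
begin

text \<open>
  \<open>$\<close> is the component selection of \<open>real ^ 'n\<close> throughout; the matrix library's
  operator of the same name is switched off to avoid ambiguous parses.
\<close>

no_notation Matrix.vec_index (infixl "$" 100)

definition hurwitz :: "real mat \<Rightarrow> bool" where
  "hurwitz A \<longleftrightarrow> (\<forall>\<mu>. eigenvalue (map_mat complex_of_real A) \<mu> \<longrightarrow> Re \<mu> < 0)"

definition eso_matrix :: "real \<Rightarrow> real \<Rightarrow> real \<Rightarrow> real mat" where
  "eso_matrix \<alpha>1 \<alpha>2 \<alpha>3 =
     mat_of_rows_list 3 [[- \<alpha>1, 1, 0],
                         [- \<alpha>2, 0, 1],
                         [- \<alpha>3, 0, 0]]"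

definition plant_solution ::
    "(real \<Rightarrow> real \<Rightarrow> real \<Rightarrow> real \<Rightarrow> real) \<Rightarrow> real \<Rightarrow> (real \<Rightarrow> real ^ 2) \<Rightarrow> (real \<Rightarrow> real) \<Rightarrow> bool" where
  "plant_solution f g x u \<longleftrightarrow>
     (\<forall>t\<ge>0. (x has_vector_derivative
        vector [x t $ 2, f (x t $ 1) (x t $ 2) (u t) t + g * u t]) (at t within {0..}))"

definition eso_solution ::
    "real \<Rightarrow> real \<Rightarrow> real \<Rightarrow> real \<Rightarrow> real \<Rightarrow> (real \<Rightarrow> real) \<Rightarrow> (real \<Rightarrow> real) \<Rightarrow> (real \<Rightarrow> real ^ 3) \<Rightarrow> bool" where
  "eso_solution g \<alpha>1 \<alpha>2 \<alpha>3 \<epsilon> y u xh \<longleftrightarrow>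
     (\<forall>t\<ge>0. (xh has_vector_derivative
        vector [xh t $ 2 + \<alpha>1 / \<epsilon> * (y t - xh t $ 1),
                xh t $ 3 + \<alpha>2 / \<epsilon>^2 * (y t - xh t $ 1) + g * u t,
                \<alpha>3 / \<epsilon>^3 * (y t - xh t $ 1)]) (at t within {0..}))"

text \<open>
  At \<open>xh $ 2 = 0\<close> the quotient is \<open>0\<close> by convention. The value of the gain there is irrelevant,
  since the control law multiplies the gain by \<open>xh $ 2\<close>.
\<close>

definition sadrc_gain :: "real \<Rightarrow> real \<Rightarrow> real \<Rightarrow> real ^ 3 \<Rightarrow> real" where
  "sadrc_gain \<delta> \<rho> \<beta> xh = min \<delta> (sqrt (((xh $ 3 - \<rho> * xh $ 1) / xh $ 2)^2 + \<beta>))"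

definition sadrc_control :: "real \<Rightarrow> real \<Rightarrow> real \<Rightarrow> real \<Rightarrow> real \<Rightarrow> real ^ 3 \<Rightarrow> real" where
  "sadrc_control g p \<delta> \<rho> \<beta> xh =
     - (1 / g) * (p * xh $ 1 + sadrc_gain \<delta> \<rho> \<beta> xh * xh $ 2 + xh $ 3)"

definition closed_loop_solution ::
    "(real \<Rightarrow> real \<Rightarrow> real \<Rightarrow> real \<Rightarrow> real) \<Rightarrow> real \<Rightarrow> real \<Rightarrow> real \<Rightarrow> real \<Rightarrow> real \<Rightarrow> real \<Rightarrow> real \<Rightarrow> real \<Rightarrow> real
      \<Rightarrow> (real \<Rightarrow> real ^ 2) \<Rightarrow> (real \<Rightarrow> real ^ 3) \<Rightarrow> bool" where
  "closed_loop_solution f g \<alpha>1 \<alpha>2 \<alpha>3 p \<delta> \<rho> \<beta> \<epsilon> x xh \<longleftrightarrow>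
     (let u = (\<lambda>t. sadrc_control g p \<delta> \<rho> \<beta> (xh t)); y = (\<lambda>t. x t $ 1)
      in plant_solution f g x u \<and> eso_solution g \<alpha>1 \<alpha>2 \<alpha>3 \<epsilon> y u xh)"

definition extended_state ::
    "(real \<Rightarrow> real \<Rightarrow> real \<Rightarrow> real \<Rightarrow> real) \<Rightarrow> (real \<Rightarrow> real ^ 2) \<Rightarrow> (real \<Rightarrow> real) \<Rightarrow> real \<Rightarrow> real ^ 3" where
  "extended_state f x u t = vector [x t $ 1, x t $ 2, f (x t $ 1) (x t $ 2) (u t) t]"

text \<open>
  The time derivative of \<open>f\<close> along a trajectory exists and is bounded by \<open>\<phi>\<close>. It is
  not expanded by the chain rule, because the feedback law has kinks (the minimum in the gain)
  and \<open>u\<close> need not be differentiable.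
\<close>

definition rate_bounded_along ::
    "(real \<Rightarrow> real \<Rightarrow> real \<Rightarrow> real \<Rightarrow> real) \<Rightarrow> (real \<Rightarrow> real ^ 2) \<Rightarrow> (real \<Rightarrow> real) \<Rightarrow> real \<Rightarrow> bool" where
  "rate_bounded_along f x u \<phi> \<longleftrightarrow>
     (\<forall>t\<ge>0. \<exists>D. ((\<lambda>s. f (x s $ 1) (x s $ 2) (u s) s) has_real_derivative D) (at t within {0..})
              \<and> \<bar>D\<bar> \<le> \<phi>)"

text \<open>
  The derivative is taken along the trajectories of the plant whose input is generated by the
  observer and the controller. The bound \<open>\<phi>\<close> is common to all \<open>\<epsilon>\<close> and all initial
  conditions.
\<close>

definition bounded_rate ::
    "(real \<Rightarrow> real \<Rightarrow> real \<Rightarrow> real \<Rightarrow> real) \<Rightarrow> real \<Rightarrow> real \<Rightarrow> real \<Rightarrow> real \<Rightarrow> real \<Rightarrow> real \<Rightarrow> real \<Rightarrow> real \<Rightarrow> bool" where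
  "bounded_rate f g \<alpha>1 \<alpha>2 \<alpha>3 p \<delta> \<rho> \<beta> \<longleftrightarrow>
     (\<exists>\<phi>>0. \<forall>\<epsilon>\<in>{0<..<1}. \<forall>x xh. closed_loop_solution f g \<alpha>1 \<alpha>2 \<alpha>3 p \<delta> \<rho> \<beta> \<epsilon> x xh \<longrightarrow>
        rate_bounded_along f x (\<lambda>t. sadrc_control g p \<delta> \<rho> \<beta> (xh t)) \<phi>)"

end

theory Submission
  imports Defs
begin

text \<open>
  Let \<open>F\<close> be the value of \<open>f\<close> along a trajectory. The scaled estimation errors
  \<open>n1 = (x1 - xh1) / \<epsilon>\<^sup>2\<close>, \<open>n2 = (x2 - xh2) / \<epsilon>\<close> and \<open>n3 = F - xh3\<close> obey \<open>\<epsilon> n' = E n + \<epsilon> (0, 0, F')\<close>,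
  whatever the control does. Since \<open>E\<close> is Hurwitz and \<open>F'\<close> is bounded, they decay like
  \<open>exp (- \<mu> t / \<epsilon>) / \<epsilon>\<^sup>2\<close> down to a residue of order \<open>\<epsilon>\<close> (\<open>eso_error_bound\<close>). From time \<open>1\<close> on the
  exponential is dominated by every power of \<open>\<epsilon>\<close>, and this already gives the third property.

  Substituting the control law, the plant becomes \<open>x1' = x2\<close>, \<open>x2' = - p x1 - d x2 + w\<close>, a damped
  oscillator whose damping \<open>d\<close> varies in time but stays between two positive constants, and whose
  input \<open>w\<close> is a combination of the estimation errors. Such an oscillator has a strict quadratic
  Lyapunov function that serves all admissible dampings at once
  (\<open>damped_oscillator_input_bound\<close>), so it forgets its initial state exponentially and answers an
  input of size \<open>\<epsilon>\<close> with a state of that size.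

  The delicate point is the joint limit in \<open>\<epsilon>\<close> and \<open>t\<close>. During the observer transient \<open>w\<close> contains
  \<open>n3\<close>, which may be as large as \<open>1 / \<epsilon>\<^sup>2\<close> for a time of order \<open>\<epsilon>\<close>; estimated by its absolute value
  it could leave \<open>x\<close> at size \<open>1 / \<epsilon>\<close>, and the slow decay from there would not be uniform in \<open>\<epsilon>\<close>.
  However, the integral of \<open>n3\<close> itself stays bounded. To exploit this, \<open>x2\<close> is replaced by
  \<open>r = xh2 + (\<alpha>2 / \<alpha>3) \<epsilon> n3\<close>: the observer injection \<open>\<alpha>2 n1\<close> that drives \<open>xh2\<close> cancels against the
  injection that drives \<open>n3\<close>, and \<open>(x1, r)\<close> is the same damped oscillator with an input bounded by
  \<open>exp (- \<mu> t / \<epsilon>) / \<epsilon> + \<epsilon>\<close> up to constants. The integral of this is bounded uniformly in \<open>\<epsilon>\<close>, so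
  the transient shifts the state by a bounded amount only
  (\<open>damped_oscillator_peaking_input_bound\<close>, \<open>sadrc_closed_loop_bounds\<close>).
\<close>

section \<open>Comparison with a supersolution\<close>

text \<open>
  Where \<open>V > 0\<close>, the hypothesis on \<open>V'\<close> says \<open>(sqrt V)' \<le> m - \<kappa> sqrt V\<close>, and \<open>B\<close> is a supersolution of
  this linear equation. The derivative of \<open>sqrt V\<close> need not exist at zeros of \<open>V\<close>, so the argument is
  run for \<open>sqrt (V + s\<^sup>2)\<close>, at the cost of an error \<open>s\<close> that tends to \<open>0\<close>. Only derivatives are
  compared; \<open>m\<close> may be too irregular to be integrated.
\<close>

lemma sqrt_comparison:
  fixes V B V' B' m :: "real \<Rightarrow> real" and \<kappa> :: real
  assumes V: "\<And>t. 0 \<le> t \<Longrightarrow> (V has_real_derivative V' t) (at t within {0..})"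
    and B: "\<And>t. 0 \<le> t \<Longrightarrow> (B has_real_derivative B' t) (at t within {0..})"
    and V_nonneg: "\<And>t. 0 \<le> t \<Longrightarrow> 0 \<le> V t"
    and m_nonneg: "\<And>t. 0 \<le> t \<Longrightarrow> 0 \<le> m t" and \<kappa>: "0 \<le> \<kappa>"
    and V_le: "\<And>t. 0 \<le> t \<Longrightarrow> V' t \<le> 2 * (m t * sqrt (V t) - \<kappa> * V t)"
    and B_ge: "\<And>t. 0 \<le> t \<Longrightarrow> m t - \<kappa> * B t \<le> B' t"
    and init: "sqrt (V 0) \<le> B 0"
    and T: "0 \<le> T"
  shows "sqrt (V T) \<le> B T"
proof (rule field_le_epsilon)
  fix s :: real assume s: "0 < s"
  define N where "N = (\<lambda>t. sqrt (V t + s\<^sup>2))"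
  define D where "D = (\<lambda>t. (N t - B t - s) * exp (\<kappa> * t))"
  define D' where "D' = (\<lambda>t. (V' t / (2 * N t) - B' t + \<kappa> * (N t - B t - s)) * exp (\<kappa> * t))"
  have N_sq: "N t * N t = V t + s\<^sup>2" and N_ge: "s \<le> N t" and V_N: "sqrt (V t) \<le> N t" if "0 \<le> t" for t
    using V_nonneg[OF that] s by (auto simp: N_def intro: real_le_rsqrt)
  have deriv: "(D has_real_derivative D' t) (at t within {0..})" if t: "0 \<le> t" for t
  proof -
    have "0 < V t + s\<^sup>2"
      using V_nonneg[OF t] s by (simp add: add_nonneg_pos)
    then show ?thesis
      unfolding D_def N_def
      by (auto intro!: derivative_eq_intros V[OF t] B[OF t] simp: D'_def N_def field_simps)
  qed
  \<comment> \<open>The integrating factor turns the two differential inequalities into monotonicity of \<open>D\<close>.\<close>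
  have nonpos: "D' t \<le> 0" if t: "0 \<le> t" for t
  proof -
    have N: "0 < N t"
      using N_ge[OF t] s by linarith
    have "V' t / (2 * N t) \<le> (m t * sqrt (V t) - \<kappa> * V t) / N t"
      using V_le[OF t] N by (simp add: field_simps)
    also have "\<dots> \<le> (m t * N t - \<kappa> * (N t * N t - s * N t)) / N t"
    proof (rule divide_right_mono)
      have "m t * sqrt (V t) \<le> m t * N t"
        using V_N[OF t] m_nonneg[OF t] by (rule mult_left_mono)
      moreover have "s\<^sup>2 \<le> s * N t"
        using N_ge[OF t] s by (simp add: power2_eq_square)
      then have "\<kappa> * (N t * N t - s * N t) \<le> \<kappa> * V t"
        using N_sq[OF t] \<kappa> by (intro mult_left_mono) auto
      ultimately show "m t * sqrt (V t) - \<kappa> * V t \<le> m t * N t - \<kappa> * (N t * N t - s * N t)"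
        by linarith
    qed (use N in simp)
    also have "\<dots> = m t - \<kappa> * (N t - s)"
      using N by (simp add: field_simps)
    finally have "V' t / (2 * N t) - B' t + \<kappa> * (N t - B t - s) \<le> 0"
      using B_ge[OF t] by (simp add: algebra_simps)
    then show ?thesis
      by (simp add: D'_def mult_nonpos_nonneg)
  qed
  have "D T \<le> D 0"
  proof (rule DERIV_nonpos_imp_decreasing_open[OF T])
    show "continuous_on {0..T} D"
      by (rule DERIV_continuous_on, rule has_field_derivative_subset[OF deriv]) auto
    fix t assume t: "0 < t" "t < T"
    have "at t within {0..} = at t"
      using t by (intro at_within_interior) auto
    then show "\<exists>y. (D has_real_derivative y) (at t) \<and> y \<le> 0"
      using deriv[of t] nonpos[of t] t by auto
  qed
  also have "D 0 \<le> 0"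
  proof -
    have "sqrt (V 0 + s\<^sup>2) \<le> sqrt (V 0) + s"
      using sqrt_add_le_add_sqrt[of "V 0" "s\<^sup>2"] V_nonneg[of 0] s by simp
    then show ?thesis
      using init by (simp add: D_def N_def)
  qed
  finally show "sqrt (V T) \<le> B T + s"
    using V_N[OF T] by (simp add: D_def mult_le_0_iff)
qed

section \<open>Oscillators with time-varying damping\<close>

text \<open>
  The energy \<open>p q\<^sup>2 + r\<^sup>2\<close> decays only through \<open>r\<close>. Adding a small multiple \<open>2 c q r\<close> makes it strictly
  decreasing in both variables, and one \<open>c\<close> serves every damping between \<open>d0\<close> and \<open>d1\<close>, however it
  varies. The conclusion bounds the state by any supersolution \<open>B\<close> of the scalar comparison
  equation; the time scale \<open>\<epsilon>\<close> is kept as a parameter because the oscillator occurs both inside the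
  fast observer and as the slow plant.
\<close>

lemma damped_oscillator_input_bound:
  fixes p d0 d1 :: real
  assumes p: "0 < p" and d0: "0 < d0"
  obtains \<kappa> K where "0 < \<kappa>" "0 < K"
    "\<And>\<epsilon> q r d v1 v2 m B B' T.
       \<lbrakk>0 < \<epsilon>;
        \<And>t. 0 \<le> t \<Longrightarrow> (q has_real_derivative (r t + v1 t) / \<epsilon>) (at t within {0..});
        \<And>t. 0 \<le> t \<Longrightarrow> (r has_real_derivative (v2 t - p * q t - d t * r t) / \<epsilon>) (at t within {0..});
        \<And>t. 0 \<le> t \<Longrightarrow> d0 \<le> d t \<and> d t \<le> d1;
        \<And>t. 0 \<le> t \<Longrightarrow> \<bar>v1 t\<bar> \<le> m t \<and> \<bar>v2 t\<bar> \<le> m t;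
        \<And>t. 0 \<le> t \<Longrightarrow> (B has_real_derivative B' t) (at t within {0..});
        \<And>t. 0 \<le> t \<Longrightarrow> (m t - \<kappa> * B t) / \<epsilon> \<le> B' t;
        \<bar>q 0\<bar> + \<bar>r 0\<bar> \<le> B 0; 0 \<le> T\<rbrakk>
       \<Longrightarrow> \<bar>q T\<bar> + \<bar>r T\<bar> \<le> K * (B T :: real)"
proof -
  \<comment> \<open>The bounds \<open>p / 2\<close> and \<open>1 / 2\<close> keep \<open>W\<close> positive definite, the third one keeps it decreasing.\<close>
  define c where "c = Min {p / 2, 1 / 2, d0 / (2 + d1\<^sup>2 / p)}"
  have "0 < 2 + d1\<^sup>2 / p"
    using p by (simp add: add_pos_nonneg)
  then have c: "0 < c" "c \<le> p / 2" "c \<le> 1 / 2" "c \<le> d0 / (2 + d1\<^sup>2 / p)"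
    using p d0 unfolding c_def by - (simp, (rule Min_le; simp)+)
  have c_d: "c * (2 + d1\<^sup>2 / p) \<le> d0"
    using c(4) \<open>0 < 2 + d1\<^sup>2 / p\<close> by (simp add: pos_le_divide_eq)
  define W where "W = (\<lambda>q r. p * q\<^sup>2 + r\<^sup>2 + 2 * c * q * r)"
  define L where "L = sqrt (2 / min 1 p)"
  define M where "M = (2 * p + 4) * L + sqrt (2 * (p + 1))"
  define \<kappa> where "\<kappa> = min (c * p) d0 / (3 * (p + 1))"
  have L: "0 < L"
    using p by (simp add: L_def)
  then have M: "0 < M"
    using p by (simp add: M_def add_pos_nonneg)
  have cross: "\<bar>2 * c * q * r\<bar> \<le> (p * q\<^sup>2 + r\<^sup>2) / 2" for q r
  proof -
    have "2 * \<bar>q * r\<bar> \<le> q\<^sup>2 + r\<^sup>2"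
      using sum_squares_bound[of "\<bar>q\<bar>" "\<bar>r\<bar>"] by (simp add: abs_mult)
    then have "c * (2 * \<bar>q * r\<bar>) \<le> c * q\<^sup>2 + c * r\<^sup>2"
      using c(1) by (simp flip: distrib_left)
    moreover have "c * q\<^sup>2 \<le> p / 2 * q\<^sup>2" "c * r\<^sup>2 \<le> 1 / 2 * r\<^sup>2"
      using c by (intro mult_right_mono; simp)+
    ultimately show ?thesis
      using c(1) by (simp add: abs_mult mult.assoc)
  qed
  have W_nonneg: "0 \<le> W q r" for q r
    using cross[of q r] p by (simp add: W_def abs_le_iff)
  have W_le: "W q r \<le> 3 / 2 * (p + 1) * (q\<^sup>2 + r\<^sup>2)" for q r
  proof -
    have "p * q\<^sup>2 + r\<^sup>2 \<le> (p + 1) * (q\<^sup>2 + r\<^sup>2)"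
      using p by (simp add: algebra_simps)
    then show ?thesis
      using cross[of q r] by (simp add: W_def abs_le_iff mult.assoc) (simp add: algebra_simps)
  qed
  have W_ge: "\<bar>q\<bar> \<le> L * sqrt (W q r)" "\<bar>r\<bar> \<le> L * sqrt (W q r)" for q r
  proof -
    define \<mu> where "\<mu> = min 1 p"
    have \<mu>: "0 < \<mu>" "\<mu> \<le> p" "\<mu> \<le> 1"
      using p by (simp_all add: \<mu>_def)
    have "\<mu> * q\<^sup>2 \<le> p * q\<^sup>2" "\<mu> * r\<^sup>2 \<le> 1 * r\<^sup>2" "0 \<le> \<mu> * q\<^sup>2" "0 \<le> \<mu> * r\<^sup>2"
      using \<mu> by (intro mult_right_mono mult_nonneg_nonneg; simp)+
    then have "\<mu> * q\<^sup>2 \<le> 2 * W q r" "\<mu> * r\<^sup>2 \<le> 2 * W q r"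
      using cross[of q r] by (simp_all add: W_def abs_le_iff)
    then have "q\<^sup>2 \<le> 2 / \<mu> * W q r" "r\<^sup>2 \<le> 2 / \<mu> * W q r"
      using \<mu> by (simp_all add: field_simps)
    then show "\<bar>q\<bar> \<le> L * sqrt (W q r)" "\<bar>r\<bar> \<le> L * sqrt (W q r)"
      by (simp_all add: L_def \<mu>_def real_sqrt_mult[symmetric] real_le_rsqrt)
  qed
  have dissipation: "2 * \<kappa> * W q r \<le> 2 * c * p * q\<^sup>2 + 2 * (d - c) * r\<^sup>2 + 2 * c * d * q * r"
    if d: "d0 \<le> d" "d \<le> d1" for q r d
  proof -
    have "2 * \<kappa> * W q r \<le> 2 * \<kappa> * (3 / 2 * (p + 1) * (q\<^sup>2 + r\<^sup>2))"
      using W_le[of q r] c p d0 by (intro mult_left_mono) (auto simp: \<kappa>_def)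
    also have "\<dots> = min (c * p) d0 * (q\<^sup>2 + r\<^sup>2)"
      using p by (simp add: \<kappa>_def field_simps)
    also have "\<dots> \<le> c * p * q\<^sup>2 + d0 * r\<^sup>2"
    proof -
      have "min (c * p) d0 * q\<^sup>2 \<le> c * p * q\<^sup>2" "min (c * p) d0 * r\<^sup>2 \<le> d0 * r\<^sup>2"
        by (intro mult_right_mono; simp)+
      then show ?thesis
        by (simp only: distrib_left)
    qed
    also have "\<dots> \<le> 2 * c * p * q\<^sup>2 + 2 * (d - c) * r\<^sup>2 + 2 * c * d * q * r"
    proof -
      \<comment> \<open>Completing the square absorbs the indefinite term into half of the \<open>q\<close>-dissipation.\<close>
      have "0 \<le> c * (p * q + d * r)\<^sup>2 / p"
        using c p by simp
      also have "\<dots> = c * p * q\<^sup>2 + 2 * c * d * q * r + c * d\<^sup>2 / p * r\<^sup>2"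
        using p by (simp add: power2_eq_square field_simps)
      finally have square: "0 \<le> c * p * q\<^sup>2 + 2 * c * d * q * r + c * d\<^sup>2 / p * r\<^sup>2" .
      have "d\<^sup>2 \<le> d1\<^sup>2"
        using d d0 by (intro power_mono) auto
      then have "c * (d\<^sup>2 / p) \<le> c * (d1\<^sup>2 / p)"
        using c p by (intro mult_left_mono divide_right_mono) auto
      then have "d0 + c * d\<^sup>2 / p \<le> 2 * (d - c)"
        using c_d d by (simp add: algebra_simps)
      then have "(d0 + c * d\<^sup>2 / p) * r\<^sup>2 \<le> 2 * (d - c) * r\<^sup>2"
        by (rule mult_right_mono) simp
      then show ?thesis
        using square by (simp only: distrib_right)
    qed
    finally show ?thesis .
  qed
  show thesis
  proof
    show "0 < \<kappa>"
      using c p d0 by (simp add: \<kappa>_def)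
    show "0 < 2 * L * M"
      using L M by simp
  next
    fix \<epsilon> T :: real and q r d v1 v2 m B B' :: "real \<Rightarrow> real"
    assume \<epsilon>: "0 < \<epsilon>"
      and q: "\<And>t. 0 \<le> t \<Longrightarrow> (q has_real_derivative (r t + v1 t) / \<epsilon>) (at t within {0..})"
      and r: "\<And>t. 0 \<le> t \<Longrightarrow>
        (r has_real_derivative (v2 t - p * q t - d t * r t) / \<epsilon>) (at t within {0..})"
      and d: "\<And>t. 0 \<le> t \<Longrightarrow> d0 \<le> d t \<and> d t \<le> d1"
      and v: "\<And>t. 0 \<le> t \<Longrightarrow> \<bar>v1 t\<bar> \<le> m t \<and> \<bar>v2 t\<bar> \<le> m t"
      and B: "\<And>t. 0 \<le> t \<Longrightarrow> (B has_real_derivative B' t) (at t within {0..})"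
      and B': "\<And>t. 0 \<le> t \<Longrightarrow> (m t - \<kappa> * B t) / \<epsilon> \<le> B' t"
      and init: "\<bar>q 0\<bar> + \<bar>r 0\<bar> \<le> B 0" and T: "0 \<le> T"
    define V' where "V' = (\<lambda>t. (2 * p * q t * (r t + v1 t)
        + 2 * r t * (v2 t - p * q t - d t * r t)
        + 2 * c * ((r t + v1 t) * r t + q t * (v2 t - p * q t - d t * r t))) / \<epsilon>)"
    have "sqrt (W (q T) (r T)) \<le> M * B T"
    proof (rule sqrt_comparison[where V = "\<lambda>t. W (q t) (r t)" and V' = V' and B = "\<lambda>t. M * B t"
          and B' = "\<lambda>t. M * B' t" and m = "\<lambda>t. M * m t / \<epsilon>" and \<kappa> = "\<kappa> / \<epsilon>"])
      fix t :: real assume t: "0 \<le> t"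
      show "((\<lambda>t. W (q t) (r t)) has_real_derivative V' t) (at t within {0..})"
        unfolding W_def using \<epsilon>
        by (auto intro!: derivative_eq_intros q[OF t] r[OF t] simp: V'_def field_simps power2_eq_square)
      show "((\<lambda>t. M * B t) has_real_derivative M * B' t) (at t within {0..})"
        by (rule DERIV_cmult[OF B[OF t]])
      have m: "0 \<le> m t"
        using v[OF t] by linarith
      then show "0 \<le> M * m t / \<epsilon>"
        using M \<epsilon> by simp
      show "0 \<le> W (q t) (r t)"
        by (rule W_nonneg)
      define w where "w = sqrt (W (q t) (r t))"
      have w: "0 \<le> w" "\<bar>q t\<bar> \<le> L * w" "\<bar>r t\<bar> \<le> L * w"
        using W_ge[where q="q t" and r="r t"] W_nonneg by (simp_all add: w_def)
      have cross_terms: "(2 * p * q t + 2 * c * r t) * v1 t + (2 * r t + 2 * c * q t) * v2 t \<le> 2 * (M * m t * w)"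
      proof -
        have sides: "\<bar>2 * p * q t + 2 * c * r t\<bar> \<le> (2 * p + 1) * (L * w)"
          "\<bar>2 * r t + 2 * c * q t\<bar> \<le> 3 * (L * w)"
        proof -
          have "2 * p * \<bar>q t\<bar> \<le> 2 * p * (L * w)" "2 * c * \<bar>r t\<bar> \<le> 1 * (L * w)"
               "2 * c * \<bar>q t\<bar> \<le> 1 * (L * w)"
            using w p c by (intro mult_mono; simp)+
          moreover have "\<bar>2 * p * q t + 2 * c * r t\<bar> \<le> 2 * p * \<bar>q t\<bar> + 2 * c * \<bar>r t\<bar>"
            "\<bar>2 * r t + 2 * c * q t\<bar> \<le> 2 * \<bar>r t\<bar> + 2 * c * \<bar>q t\<bar>"
            using p c abs_triangle_ineq[of "2 * p * q t" "2 * c * r t"]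
              abs_triangle_ineq[of "2 * r t" "2 * c * q t"] by (simp_all add: abs_mult)
          ultimately show "\<bar>2 * p * q t + 2 * c * r t\<bar> \<le> (2 * p + 1) * (L * w)"
            "\<bar>2 * r t + 2 * c * q t\<bar> \<le> 3 * (L * w)"
            using w(3) by (simp_all add: algebra_simps)
        qed
        have "(2 * p * q t + 2 * c * r t) * v1 t \<le> (2 * p + 1) * (L * w) * m t"
          by (rule order_trans[OF abs_ge_self], subst abs_mult, rule mult_mono) (use sides v[OF t] p L w in auto)
        moreover have "(2 * r t + 2 * c * q t) * v2 t \<le> 3 * (L * w) * m t"
          by (rule order_trans[OF abs_ge_self], subst abs_mult, rule mult_mono) (use sides v[OF t] p L w in auto)
        moreover have "((2 * p + 4) * L) * (m t * w) \<le> M * (m t * w)"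
          using m w p by (intro mult_right_mono) (auto simp: M_def)
        moreover have "0 \<le> M * (m t * w)"
          using m w M by simp
        ultimately show ?thesis
          by (simp add: algebra_simps)
      qed
      have "\<epsilon> * V' t = (2 * p * q t + 2 * c * r t) * v1 t + (2 * r t + 2 * c * q t) * v2 t
          - (2 * c * p * (q t)\<^sup>2 + 2 * (d t - c) * (r t)\<^sup>2 + 2 * c * d t * q t * r t)"
        using \<epsilon> by (simp add: V'_def power2_eq_square) (simp add: algebra_simps)
      also have "\<dots> \<le> 2 * (M * m t * w) - 2 * \<kappa> * W (q t) (r t)"
        using cross_terms dissipation[of "d t" "q t" "r t"] d[OF t] by linarith
      finally show "V' t \<le> 2 * (M * m t / \<epsilon> * sqrt (W (q t) (r t)) - \<kappa> / \<epsilon> * W (q t) (r t))"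
        using \<epsilon> by (simp add: w_def field_simps)
      show "M * m t / \<epsilon> - \<kappa> / \<epsilon> * (M * B t) \<le> M * B' t"
        using mult_left_mono[OF B'[OF t], of M] M
          by (simp add: right_diff_distrib diff_divide_distrib mult.left_commute)
    next
      have "W (q 0) (r 0) \<le> 3 / 2 * (p + 1) * ((q 0)\<^sup>2 + (r 0)\<^sup>2)"
        by (rule W_le)
      also have "\<dots> \<le> 2 * (p + 1) * (\<bar>q 0\<bar> + \<bar>r 0\<bar>)\<^sup>2"
        using p by (intro mult_mono) (auto simp: power2_sum)
      finally have "sqrt (W (q 0) (r 0)) \<le> sqrt (2 * (p + 1)) * (\<bar>q 0\<bar> + \<bar>r 0\<bar>)"
        using real_sqrt_le_mono by (fastforce simp: real_sqrt_mult)
      also have "\<dots> \<le> M * B 0"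
        using init L p by (intro mult_mono) (auto simp: M_def)
      finally show "sqrt (W (q 0) (r 0)) \<le> M * B 0" .
    qed (use T \<epsilon> c p d0 in \<open>auto simp: \<kappa>_def\<close>)
    then have "L * sqrt (W (q T) (r T)) \<le> L * (M * B T)"
      using L by simp
    then show "\<bar>q T\<bar> + \<bar>r T\<bar> \<le> 2 * L * M * B T"
      using W_ge[where q="q T" and r="r T"] by simp
  qed
qed

section \<open>The extended state observer\<close>

text \<open>
  A Routh-Hurwitz criterion in factored form: the characteristic polynomial is
  \<open>(z + a) (z\<^sup>2 + b z + c)\<close>. A real cubic has a real root \<open>- a\<close>, the remaining factor is a real quadratic,
  and each of its coefficients is positive because its roots lie in the left half-plane.
\<close>

lemma hurwitz_eso_matrix_factors:
  assumes "hurwitz (eso_matrix \<alpha>1 \<alpha>2 \<alpha>3)"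
  obtains a b c where "0 < a" "0 < b" "0 < c"
    "\<alpha>1 = a + b" "\<alpha>2 = a * b + c" "\<alpha>3 = a * c"
proof -
  have root_neg: "Re z < 0" if z: "z ^ 3 + \<alpha>1 * z\<^sup>2 + \<alpha>2 * z + \<alpha>3 = 0" for z :: complex
  proof -
    define A where "A = map_mat complex_of_real (eso_matrix \<alpha>1 \<alpha>2 \<alpha>3)"
    \<comment> \<open>The eigenvector for a root \<open>z\<close>, normalised to first entry \<open>1\<close>.\<close>
    define v where "v = vec_of_list [1, z + \<alpha>1, z\<^sup>2 + \<alpha>1 * z + \<alpha>2]"
    have dims: "dim_row A = 3" "dim_col A = 3" "dim_vec v = 3"
      by (simp_all add: A_def v_def eso_matrix_def mat_of_rows_list_def)
    have z': "complex_of_real \<alpha>3 = - (z ^ 3 + \<alpha>1 * z\<^sup>2 + \<alpha>2 * z)"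
      using z unfolding eq_neg_iff_add_eq_0 by (simp add: add_ac)
    have "A *\<^sub>v v = z \<cdot>\<^sub>v v"
    proof (rule eq_vecI)
      fix i assume "i < dim_vec (z \<cdot>\<^sub>v v)"
      then consider "i = 0" | "i = 1" | "i = 2"
        using dims by force
      then show "vec_index (A *\<^sub>v v) i = vec_index (z \<cdot>\<^sub>v v) i"
        by cases (auto simp: z' A_def v_def eso_matrix_def mat_of_rows_list_def scalar_prod_def
            numeral_3_eq_3 numeral_2_eq_2 power2_eq_square power3_eq_cube algebra_simps)
    qed (use dims in simp)
    moreover have "vec_index v 0 \<noteq> vec_index (0\<^sub>v 3) 0"
      by (simp add: v_def)
    then have "v \<noteq> 0\<^sub>v 3"
      by metis
    moreover have "v \<in> carrier_vec 3"
      using dims(3) by (rule carrier_vecI)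
    ultimately have "eigenvalue A z"
      unfolding eigenvalue_def eigenvector_def dims by blast
    then show ?thesis
      using assms by (simp add: hurwitz_def A_def)
  qed
  obtain s :: real where s: "s ^ 3 + \<alpha>1 * s\<^sup>2 + \<alpha>2 * s + \<alpha>3 = 0"
  proof -
    define P where "P = (\<lambda>s :: real. s ^ 3 + \<alpha>1 * s\<^sup>2 + \<alpha>2 * s + \<alpha>3)"
    define M where "M = 1 + \<bar>\<alpha>1\<bar> + \<bar>\<alpha>2\<bar> + \<bar>\<alpha>3\<bar>"
    have M: "1 \<le> M" "M \<le> M\<^sup>2"
      by (simp_all add: M_def self_le_power)
    have bound: "\<bar>\<alpha>1 * s\<^sup>2 + \<alpha>2 * s + \<alpha>3\<bar> \<le> M ^ 3" if "\<bar>s\<bar> = M" for s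
    proof -
      have "s\<^sup>2 = M\<^sup>2"
        using that by (metis power2_abs)
      then have "\<bar>\<alpha>1 * s\<^sup>2 + \<alpha>2 * s + \<alpha>3\<bar> \<le> \<bar>\<alpha>1\<bar> * M\<^sup>2 + \<bar>\<alpha>2\<bar> * M + \<bar>\<alpha>3\<bar>"
        using that abs_triangle_ineq[of "\<alpha>1 * s\<^sup>2 + \<alpha>2 * s" \<alpha>3] abs_triangle_ineq[of "\<alpha>1 * s\<^sup>2" "\<alpha>2 * s"]
        by (simp add: abs_mult)
      also have "\<dots> \<le> \<bar>\<alpha>1\<bar> * M\<^sup>2 + \<bar>\<alpha>2\<bar> * M\<^sup>2 + \<bar>\<alpha>3\<bar> * M\<^sup>2"
      proof -
        have "\<bar>\<alpha>2\<bar> * M \<le> \<bar>\<alpha>2\<bar> * M\<^sup>2" "\<bar>\<alpha>3\<bar> * 1 \<le> \<bar>\<alpha>3\<bar> * M\<^sup>2"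
          using M by (intro mult_left_mono; simp)+
        then show ?thesis
          by simp
      qed
      also have "\<dots> = (M - 1) * M\<^sup>2"
        by (simp add: M_def algebra_simps)
      also have "\<dots> \<le> M ^ 3"
        by (simp add: power2_eq_square power3_eq_cube algebra_simps)
      finally show ?thesis .
    qed
    have "P (- M) \<le> 0" "0 \<le> P M"
      using bound[of "- M"] bound[of M] M(1) by (simp_all add: P_def abs_le_iff)
    moreover have "continuous_on {- M..M} P"
      unfolding P_def by (intro continuous_intros)
    ultimately obtain s where "P s = 0"
      using IVT'[of P "- M" 0 M] M(1) by auto
    then show thesis
      using that by (simp add: P_def)
  qed
  define a where "a = - s"
  define b where "b = \<alpha>1 - a"
  define c where "c = \<alpha>2 - a * b"
  have coeffs: "\<alpha>1 = a + b" "\<alpha>2 = a * b + c" "\<alpha>3 = a * c"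
    using s by (simp_all add: a_def b_def c_def power2_eq_square power3_eq_cube algebra_simps)
  have "Re (complex_of_real s) < 0"
    using s by (intro root_neg) (metis of_real_0 of_real_add of_real_mult of_real_power)
  then have a: "0 < a"
    by (simp add: a_def)
  \<comment> \<open>The principal square root makes \<open>z\<close> the root of the quadratic with the larger real part.\<close>
  define w where "w = csqrt (of_real (b\<^sup>2 - 4 * c))"
  define z where "z = (w - b) / 2"
  have "w\<^sup>2 = of_real (b\<^sup>2 - 4 * c)"
    by (simp add: w_def)
  moreover have "z\<^sup>2 + b * z + c = (w\<^sup>2 - of_real (b\<^sup>2 - 4 * c)) / 4"
    by (simp add: z_def power2_eq_square field_simps)
  ultimately have quad: "z\<^sup>2 + b * z + c = 0"
    by simp
  have "z ^ 3 + \<alpha>1 * z\<^sup>2 + \<alpha>2 * z + \<alpha>3 = (z + a) * (z\<^sup>2 + b * z + c)"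
    by (simp add: coeffs power2_eq_square power3_eq_cube algebra_simps)
  then have "Re z < 0"
    using quad by (intro root_neg) simp
  then have w: "Re w < b"
    by (simp add: z_def)
  then have b: "0 < b"
    using Re_csqrt[of "of_real (b\<^sup>2 - 4 * c)"] unfolding w_def by linarith
  have "0 < c"
  proof (cases "4 * c \<le> b\<^sup>2")
    case True
    then have "w = of_real (sqrt (b\<^sup>2 - 4 * c))"
      unfolding w_def by (intro csqrt_of_real) simp
    then have "sqrt (b\<^sup>2 - 4 * c) < sqrt (b\<^sup>2)"
      using w b by simp
    then have "b\<^sup>2 - 4 * c < b\<^sup>2"
      by (simp only: real_sqrt_less_iff)
    then show ?thesis
      by simp
  next
    case False
    then show ?thesis
      using zero_le_power2[of b] by linarith
  qed
  then show thesis
    using that a b coeffs by blast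
qed

text \<open>
  The factorisation brings the error system into cascade form. With \<open>\<xi> = a\<^sup>2 n1 - a n2 + n3\<close> (from the
  left eigenvector of \<open>E\<close> for \<open>- a\<close>) and \<open>\<zeta> = n2 - a n1\<close> one has \<open>\<epsilon> \<xi>' = - a \<xi> + \<epsilon> h\<close>, while \<open>(\<zeta>, - c n1)\<close>
  is a damped oscillator with stiffness \<open>c\<close> and constant damping \<open>b\<close>, driven by \<open>\<xi>\<close>.
\<close>

lemma eso_error_bound:
  assumes "hurwitz (eso_matrix \<alpha>1 \<alpha>2 \<alpha>3)"
  obtains \<mu> C where "0 < \<mu>" "0 < C"
    "\<And>\<epsilon> A \<phi> n1 n2 n3 h T.
       \<lbrakk>0 < \<epsilon>;
        \<And>t. 0 \<le> t \<Longrightarrow> (n1 has_real_derivative (n2 t - \<alpha>1 * n1 t) / \<epsilon>) (at t within {0..});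
        \<And>t. 0 \<le> t \<Longrightarrow> (n2 has_real_derivative (n3 t - \<alpha>2 * n1 t) / \<epsilon>) (at t within {0..});
        \<And>t. 0 \<le> t \<Longrightarrow> (n3 has_real_derivative h t - \<alpha>3 * n1 t / \<epsilon>) (at t within {0..});
        \<And>t. 0 \<le> t \<Longrightarrow> \<bar>h t\<bar> \<le> \<phi>;
        \<bar>n1 0\<bar> + \<bar>n2 0\<bar> + \<bar>n3 0\<bar> \<le> A; 0 \<le> T\<rbrakk>
       \<Longrightarrow> \<bar>n1 T\<bar> + \<bar>n2 T\<bar> + \<bar>n3 T\<bar> \<le> C * (A * exp (- \<mu> * T / \<epsilon>) + \<phi> * \<epsilon> :: real)"
proof -
  obtain a b c where abc: "0 < a" "0 < b" "0 < c"
    and \<alpha>: "\<alpha>1 = a + b" "\<alpha>2 = a * b + c" "\<alpha>3 = a * c"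
    using hurwitz_eso_matrix_factors[OF assms] .
  show thesis
  proof (rule damped_oscillator_input_bound[OF abc(3,2), where ?d1.0 = b], goal_cases)
    case (1 \<kappa> K)
    note \<kappa> = 1(1) and K = 1(2) and oscillator = 1(3)
    \<comment> \<open>Strictly slower than the oscillator, so that it can follow an input decaying at rate \<open>\<mu>\<close>.\<close>
    define \<mu> where "\<mu> = min a \<kappa> / 2"
    have \<mu>: "0 < \<mu>" "\<mu> \<le> a" "\<mu> < \<kappa>"
      using abc \<kappa> by (auto simp: \<mu>_def min_def)
    define L where "L = a\<^sup>2 + a + 1"
    define G where "G = L / (\<kappa> - \<mu>) + (1 + a + c)"
    define C where "C = (L + 1 / a) + (1 + a) * (1 + 1 / c) * K * (G + 1 / (a * \<kappa>))"
    have L: "0 < L"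
      using abc by (simp add: L_def add_pos_pos)
    have "(\<kappa> - \<mu>) * G = L + (\<kappa> - \<mu>) * (1 + a + c)"
      using \<mu> by (simp add: G_def field_simps)
    moreover have "0 < L / (\<kappa> - \<mu>)" "0 < (\<kappa> - \<mu>) * (1 + a + c)"
      using L \<mu> abc by simp_all
    ultimately have G: "0 < G" "L \<le> (\<kappa> - \<mu>) * G" "1 + a + c \<le> G"
      using abc unfolding G_def by linarith+
    have C: "0 < C"
      using abc L G \<kappa> K by (simp add: C_def add_pos_pos)
    show thesis
    proof (rule that[OF \<mu>(1) C])
      fix \<epsilon> A \<phi> T :: real and n1 n2 n3 h :: "real \<Rightarrow> real"
      assume \<epsilon>: "0 < \<epsilon>"
        and n1: "\<And>t. 0 \<le> t \<Longrightarrow> (n1 has_real_derivative (n2 t - \<alpha>1 * n1 t) / \<epsilon>) (at t within {0..})"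
        and n2: "\<And>t. 0 \<le> t \<Longrightarrow> (n2 has_real_derivative (n3 t - \<alpha>2 * n1 t) / \<epsilon>) (at t within {0..})"
        and n3: "\<And>t. 0 \<le> t \<Longrightarrow> (n3 has_real_derivative h t - \<alpha>3 * n1 t / \<epsilon>) (at t within {0..})"
        and h: "\<And>t. 0 \<le> t \<Longrightarrow> \<bar>h t\<bar> \<le> \<phi>"
        and init: "\<bar>n1 0\<bar> + \<bar>n2 0\<bar> + \<bar>n3 0\<bar> \<le> A" and T: "0 \<le> T"
      have \<phi>: "0 \<le> \<phi>"
        using h[of 0] by simp
      have A: "0 \<le> A"
        using init by linarith
      define \<zeta> where "\<zeta> = (\<lambda>t. n2 t - a * n1 t)"
      define \<xi> where "\<xi> = (\<lambda>t. a\<^sup>2 * n1 t - a * n2 t + n3 t)"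
      define e where "e = (\<lambda>t. exp (- \<mu> * t / \<epsilon>))"
      define X where "X = (\<lambda>t. L * A * e t + \<phi> / a * \<epsilon>)"
      define B where "B = (\<lambda>t. G * A * e t + \<phi> / (a * \<kappa>) * \<epsilon>)"
      have e_pos: "0 < e t" for t
        by (simp add: e_def)
      have e_deriv: "(e has_real_derivative - \<mu> / \<epsilon> * e t) (at t within S)" for t S
        unfolding e_def using \<epsilon> by (auto intro!: derivative_eq_intros simp: field_simps)
      have \<xi>_le: "\<bar>\<xi> t\<bar> \<le> X t" if t: "0 \<le> t" for t
      proof -
        have "sqrt ((\<xi> t)\<^sup>2) \<le> X t"
        proof (rule sqrt_comparison[where V = "\<lambda>t. (\<xi> t)\<^sup>2" and V' = "\<lambda>t. 2 * \<xi> t * (h t - a / \<epsilon> * \<xi> t)"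
              and B = X and B' = "\<lambda>t. L * A * (- \<mu> / \<epsilon> * e t)" and m = "\<lambda>t. \<phi>" and \<kappa> = "a / \<epsilon>" and T = t])
          fix t :: real assume t: "0 \<le> t"
          have "(\<xi> has_real_derivative h t - a / \<epsilon> * \<xi> t) (at t within {0..})"
            unfolding \<xi>_def using \<epsilon>
            by (auto intro!: derivative_eq_intros n1[OF t] n2[OF t] n3[OF t]
                simp: \<alpha> power2_eq_square field_simps)
          then show "((\<lambda>t. (\<xi> t)\<^sup>2) has_real_derivative 2 * \<xi> t * (h t - a / \<epsilon> * \<xi> t)) (at t within {0..})"
            by (auto intro!: derivative_eq_intros)
          show "(X has_real_derivative L * A * (- \<mu> / \<epsilon> * e t)) (at t within {0..})"
            unfolding X_def by (auto intro!: derivative_eq_intros e_deriv)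
          have "\<xi> t * h t \<le> \<phi> * \<bar>\<xi> t\<bar>"
            using mult_right_mono[OF h[OF t], of "\<bar>\<xi> t\<bar>"] abs_ge_self[of "\<xi> t * h t"]
            by (simp add: abs_mult mult.commute)
          then show "2 * \<xi> t * (h t - a / \<epsilon> * \<xi> t) \<le> 2 * (\<phi> * sqrt ((\<xi> t)\<^sup>2) - a / \<epsilon> * (\<xi> t)\<^sup>2)"
            by (simp add: power2_eq_square algebra_simps)
          have "\<mu> * (L * A * e t) \<le> a * (L * A * e t)"
            using \<mu> L A e_pos[of t] by (intro mult_right_mono) auto
          then show "\<phi> - a / \<epsilon> * X t \<le> L * A * (- \<mu> / \<epsilon> * e t)"
            using \<epsilon> abc by (simp add: X_def field_simps)
        next
          have "\<bar>\<xi> 0\<bar> \<le> a\<^sup>2 * \<bar>n1 0\<bar> + a * \<bar>n2 0\<bar> + \<bar>n3 0\<bar>"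
            using abc(1) abs_triangle_ineq[of "a\<^sup>2 * n1 0 - a * n2 0" "n3 0"]
              abs_triangle_ineq4[of "a\<^sup>2 * n1 0" "a * n2 0"] by (simp add: \<xi>_def abs_mult)
          also have "\<dots> \<le> L * \<bar>n1 0\<bar> + L * \<bar>n2 0\<bar> + L * \<bar>n3 0\<bar>"
            using abc(1) by (intro add_mono mult_right_mono mult_right_mono[of 1 L "\<bar>n3 0\<bar>", simplified])
              (auto simp: L_def)
          also have "\<dots> \<le> L * A"
            using mult_left_mono[OF init, of L] L by (simp add: algebra_simps)
          also have "\<dots> \<le> X 0"
            using \<phi> abc \<epsilon> by (simp add: X_def e_def)
          finally show "sqrt ((\<xi> 0)\<^sup>2) \<le> X 0"
            by simp
        qed (use \<phi> abc \<epsilon> t in auto)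
        then show ?thesis
          by simp
      qed
      have "\<bar>\<zeta> T\<bar> + \<bar>- c * n1 T\<bar> \<le> K * B T"
      proof (rule oscillator[where q = \<zeta> and r = "\<lambda>t. - c * n1 t" and \<epsilon> = \<epsilon> and ?v1.0 = \<xi> and ?v2.0 = "\<lambda>t. 0"
            and d = "\<lambda>t. b" and m = X and B' = "\<lambda>t. G * A * (- \<mu> / \<epsilon> * e t)" and B = B])
        fix t :: real assume t: "0 \<le> t"
        show "(\<zeta> has_real_derivative (- c * n1 t + \<xi> t) / \<epsilon>) (at t within {0..})"
          unfolding \<zeta>_def \<xi>_def using \<epsilon>
          by (auto intro!: derivative_eq_intros n1[OF t] n2[OF t] simp: \<alpha> power2_eq_square field_simps)
        show "((\<lambda>t. - c * n1 t) has_real_derivative (0 - c * \<zeta> t - b * (- c * n1 t)) / \<epsilon>) (at t within {0..})"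
          unfolding \<zeta>_def using \<epsilon>
          by (auto intro!: derivative_eq_intros n1[OF t] simp: \<alpha> field_simps)
        show "\<bar>\<xi> t\<bar> \<le> X t \<and> \<bar>0\<bar> \<le> X t"
          using \<xi>_le[OF t] by auto
        show "(B has_real_derivative G * A * (- \<mu> / \<epsilon> * e t)) (at t within {0..})"
          unfolding B_def by (auto intro!: derivative_eq_intros e_deriv)
        have "L * (A * e t) \<le> (\<kappa> - \<mu>) * G * (A * e t)"
          using G A e_pos[of t] by (intro mult_right_mono) auto
        moreover have "\<kappa> * B t = \<kappa> * (G * A * e t) + \<phi> / a * \<epsilon>"
          using \<kappa> by (simp add: B_def field_simps)
        ultimately have "X t - \<kappa> * B t \<le> - \<mu> * (G * A * e t)"
          by (simp add: X_def algebra_simps)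
        then show "(X t - \<kappa> * B t) / \<epsilon> \<le> G * A * (- \<mu> / \<epsilon> * e t)"
          using divide_right_mono[of "X t - \<kappa> * B t" "- \<mu> * (G * A * e t)" \<epsilon>] \<epsilon> by (simp add: ac_simps)
      next
        have "\<bar>\<zeta> 0\<bar> + \<bar>- c * n1 0\<bar> \<le> \<bar>n2 0\<bar> + (a + c) * \<bar>n1 0\<bar>"
          using abc abs_triangle_ineq4[of "n2 0" "a * n1 0"] by (simp add: \<zeta>_def abs_mult algebra_simps)
        also have "\<dots> \<le> (1 + a + c) * \<bar>n1 0\<bar> + (1 + a + c) * \<bar>n2 0\<bar> + (1 + a + c) * \<bar>n3 0\<bar>"
          using abc by (simp add: algebra_simps add_nonneg_nonneg)
        also have "\<dots> \<le> (1 + a + c) * A"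
          using mult_left_mono[OF init, of "1 + a + c"] abc by (simp add: algebra_simps)
        also have "\<dots> \<le> G * A"
          using G A by (intro mult_right_mono) auto
        also have "\<dots> \<le> B 0"
          using \<phi> abc \<kappa> \<epsilon> by (simp add: B_def e_def)
        finally show "\<bar>\<zeta> 0\<bar> + \<bar>- c * n1 0\<bar> \<le> B 0" .
      qed (use \<epsilon> T in auto)
      then have \<zeta>_n1: "\<bar>\<zeta> T\<bar> + c * \<bar>n1 T\<bar> \<le> K * B T"
        using abc by (simp add: abs_mult)
      then have "\<bar>\<zeta> T\<bar> \<le> K * B T" "c * \<bar>n1 T\<bar> \<le> K * B T"
        using abc mult_nonneg_nonneg[of c "\<bar>n1 T\<bar>"] by linarith+
      then have "\<bar>\<zeta> T\<bar> + \<bar>n1 T\<bar> \<le> (1 + 1 / c) * (K * B T)"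
        using abc pos_le_divide_eq[of c "\<bar>n1 T\<bar>" "K * B T"] by (simp add: distrib_right mult.commute[of c])
      then have "(1 + a) * (\<bar>\<zeta> T\<bar> + \<bar>n1 T\<bar>) \<le> (1 + a) * ((1 + 1 / c) * (K * B T))"
        using abc by (intro mult_left_mono) auto
      moreover have "\<bar>n1 T\<bar> + \<bar>n2 T\<bar> + \<bar>n3 T\<bar> \<le> \<bar>\<xi> T\<bar> + (1 + a) * (\<bar>\<zeta> T\<bar> + \<bar>n1 T\<bar>)"
      proof -
        have "n2 T = \<zeta> T + a * n1 T" "n3 T = \<xi> T + a * \<zeta> T"
          by (simp_all add: \<zeta>_def \<xi>_def power2_eq_square algebra_simps)
        then have "\<bar>n2 T\<bar> \<le> \<bar>\<zeta> T\<bar> + a * \<bar>n1 T\<bar>" "\<bar>n3 T\<bar> \<le> \<bar>\<xi> T\<bar> + a * \<bar>\<zeta> T\<bar>"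
          using abc abs_triangle_ineq[of "\<zeta> T" "a * n1 T"] abs_triangle_ineq[of "\<xi> T" "a * \<zeta> T"]
          by (simp_all add: abs_mult)
        then show ?thesis
          by (simp add: algebra_simps)
      qed
      moreover have "\<bar>\<xi> T\<bar> \<le> (L + 1 / a) * (A * e T + \<phi> * \<epsilon>)"
      proof -
        have "0 \<le> A * e T / a" "0 \<le> L * (\<phi> * \<epsilon>)"
          using A e_pos[of T] abc L \<phi> \<epsilon> by simp_all
        then show ?thesis
          using \<xi>_le[OF T] by (simp add: X_def algebra_simps)
      qed
      moreover have "(1 + a) * ((1 + 1 / c) * (K * B T))
          \<le> (1 + a) * ((1 + 1 / c) * (K * ((G + 1 / (a * \<kappa>)) * (A * e T + \<phi> * \<epsilon>))))"
      proof -
        have "0 \<le> A * e T / (a * \<kappa>)" "0 \<le> G * (\<phi> * \<epsilon>)"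
          using A e_pos[of T] abc G \<phi> \<epsilon> \<kappa> by simp_all
        then have "B T \<le> (G + 1 / (a * \<kappa>)) * (A * e T + \<phi> * \<epsilon>)"
          by (simp add: B_def algebra_simps)
        then show ?thesis
          using abc K by (intro mult_left_mono) auto
      qed
      ultimately have "\<bar>n1 T\<bar> + \<bar>n2 T\<bar> + \<bar>n3 T\<bar> \<le> C * (A * e T + \<phi> * \<epsilon>)"
        by (simp add: C_def distrib_right mult.assoc)
      then show "\<bar>n1 T\<bar> + \<bar>n2 T\<bar> + \<bar>n3 T\<bar> \<le> C * (A * exp (- \<mu> * T / \<epsilon>) + \<phi> * \<epsilon>)"
        by (simp add: e_def)
    qed
  qed
qed

section \<open>The closed loop\<close>

text \<open>
  An input of height \<open>A / \<epsilon>\<close> that lasts for a time of order \<open>\<epsilon>\<close> acts like an impulse of size \<open>A\<close>: up to a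
  constant it only adds \<open>A\<close> to the initial state, uniformly in \<open>\<epsilon>\<close>.
\<close>

lemma damped_oscillator_peaking_input_bound:
  fixes p d0 d1 \<mu> :: real
  assumes p: "0 < p" and d0: "0 < d0" and \<mu>: "0 < \<mu>"
  obtains \<kappa> K where "0 < \<kappa>" "0 < K"
    "\<And>\<epsilon> q r d v1 v2 A D R T.
       \<lbrakk>0 < \<epsilon>; \<epsilon> < 1; 0 \<le> A; 0 \<le> D;
        \<And>t. 0 \<le> t \<Longrightarrow> (q has_real_derivative r t + v1 t) (at t within {0..});
        \<And>t. 0 \<le> t \<Longrightarrow> (r has_real_derivative v2 t - p * q t - d t * r t) (at t within {0..});
        \<And>t. 0 \<le> t \<Longrightarrow> d0 \<le> d t \<and> d t \<le> d1;
        \<And>t. 0 \<le> t \<Longrightarrow> \<bar>v1 t\<bar> \<le> A / \<epsilon> * exp (- \<mu> * t / \<epsilon>) + D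
                       \<and> \<bar>v2 t\<bar> \<le> A / \<epsilon> * exp (- \<mu> * t / \<epsilon>) + D;
        \<bar>q 0\<bar> + \<bar>r 0\<bar> \<le> R; 0 \<le> T\<rbrakk>
       \<Longrightarrow> \<bar>q T\<bar> + \<bar>r T\<bar> \<le> K * ((R + A) * exp (- \<kappa> * T) + D)"
proof -
  show thesis
  proof (rule damped_oscillator_input_bound[OF p d0, where ?d1.0 = d1], goal_cases)
    case (1 \<kappa>0 K)
    note \<kappa>0 = 1(1) and K = 1(2) and oscillator = 1(3)
    \<comment> \<open>Since \<open>\<epsilon> < 1\<close>, this is at most half of the rate \<open>\<mu> / \<epsilon>\<close> of the peak.\<close>
    define \<kappa> where "\<kappa> = min \<kappa>0 (\<mu> / 2)"
    have \<kappa>: "0 < \<kappa>" "\<kappa> \<le> \<kappa>0" "\<kappa> \<le> \<mu> / 2"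
      using \<kappa>0 \<mu> by (simp_all add: \<kappa>_def)
    define J where "J = 1 + 2 / \<mu> + 1 / \<kappa>0"
    have J: "0 < J"
      using \<mu> \<kappa>0 by (simp add: J_def add_pos_pos)
    show thesis
    proof (rule that[of \<kappa> "K * J"])
      fix \<epsilon> A D R T :: real and q r d v1 v2 :: "real \<Rightarrow> real"
      assume \<epsilon>: "0 < \<epsilon>" "\<epsilon> < 1" and A: "0 \<le> A" and D: "0 \<le> D"
        and q: "\<And>t. 0 \<le> t \<Longrightarrow> (q has_real_derivative r t + v1 t) (at t within {0..})"
        and r: "\<And>t. 0 \<le> t \<Longrightarrow> (r has_real_derivative v2 t - p * q t - d t * r t) (at t within {0..})"
        and d: "\<And>t. 0 \<le> t \<Longrightarrow> d0 \<le> d t \<and> d t \<le> d1"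
        and v: "\<And>t. 0 \<le> t \<Longrightarrow> \<bar>v1 t\<bar> \<le> A / \<epsilon> * exp (- \<mu> * t / \<epsilon>) + D
                         \<and> \<bar>v2 t\<bar> \<le> A / \<epsilon> * exp (- \<mu> * t / \<epsilon>) + D"
        and init: "\<bar>q 0\<bar> + \<bar>r 0\<bar> \<le> R" and T: "0 \<le> T"
      have R: "0 \<le> R"
        using init by linarith
      \<comment> \<open>The term \<open>- H * e t\<close> in \<open>B\<close> grows fast enough to pay for the peak; \<open>R + H\<close> keeps \<open>B 0\<close> above \<open>R\<close>.\<close>
      define H where "H = 2 * A / \<mu>"
      have H: "0 \<le> H"
        using A \<mu> by (simp add: H_def)
      define e where "e = (\<lambda>t. exp (- \<mu> * t / \<epsilon>))"
      define f where "f = (\<lambda>t. exp (- \<kappa> * t))"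
      define B where "B = (\<lambda>t. (R + H) * f t - H * e t + D / \<kappa>0)"
      have rate: "\<kappa> \<le> \<mu> / (2 * \<epsilon>)"
      proof -
        have "\<mu> * \<epsilon> \<le> \<mu> * 1"
          using \<epsilon> \<mu> by (intro mult_left_mono) auto
        then have "\<mu> / 2 \<le> \<mu> / (2 * \<epsilon>)"
          using \<epsilon> by (simp add: field_simps)
        then show ?thesis
          using \<kappa> by linarith
      qed
      have e_le_f: "e t \<le> f t" and e_pos: "0 < e t" if "0 \<le> t" for t
      proof -
        have "\<kappa> * t \<le> \<mu> / \<epsilon> * t"
          using rate \<mu> \<epsilon> that by (intro mult_right_mono) (auto simp: field_simps)
        then show "e t \<le> f t" "0 < e t"
          by (simp_all add: e_def f_def)
      qed
      have "\<bar>q T\<bar> + \<bar>r T\<bar> \<le> K * B T"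
      proof (rule oscillator[where q = q and r = r and \<epsilon> = 1 and ?v1.0 = v1 and ?v2.0 = v2 and d = d
            and m = "\<lambda>t. A / \<epsilon> * e t + D" and B = B
            and B' = "\<lambda>t. - \<kappa> * (R + H) * f t + H * \<mu> / \<epsilon> * e t"])
        fix t :: real assume t: "0 \<le> t"
        show "(q has_real_derivative (r t + v1 t) / 1) (at t within {0..})"
          using q[OF t] by simp
        show "(r has_real_derivative (v2 t - p * q t - d t * r t) / 1) (at t within {0..})"
          using r[OF t] by simp
        show "d0 \<le> d t \<and> d t \<le> d1"
          by (rule d[OF t])
        show "\<bar>v1 t\<bar> \<le> A / \<epsilon> * e t + D \<and> \<bar>v2 t\<bar> \<le> A / \<epsilon> * e t + D"
          using v[OF t] by (simp add: e_def)
        show "(B has_real_derivative - \<kappa> * (R + H) * f t + H * \<mu> / \<epsilon> * e t) (at t within {0..})"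
          unfolding B_def e_def f_def using \<epsilon> by (auto intro!: derivative_eq_intros simp: field_simps)
        have "(\<kappa>0 - \<kappa>) * (H * e t) \<le> (\<kappa>0 - \<kappa>) * ((R + H) * f t)"
          using \<kappa> H R e_le_f[OF t] e_pos[OF t] by (intro mult_left_mono mult_mono) auto
        moreover have "\<kappa> * (H * e t) \<le> \<mu> / (2 * \<epsilon>) * (H * e t)"
          using rate H e_pos[OF t] by (intro mult_right_mono) auto
        moreover have "\<mu> / (2 * \<epsilon>) * (H * e t) = A / \<epsilon> * e t"
          using \<mu> by (simp add: H_def)
        moreover have "H * \<mu> / \<epsilon> * e t = 2 * (A / \<epsilon> * e t)"
          using \<mu> by (simp add: H_def)
        moreover have "\<kappa>0 * B t = \<kappa>0 * ((R + H) * f t) - \<kappa>0 * (H * e t) + D"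
          using \<kappa>0 by (simp add: B_def algebra_simps)
        ultimately show "(A / \<epsilon> * e t + D - \<kappa>0 * B t) / 1 \<le> - \<kappa> * (R + H) * f t + H * \<mu> / \<epsilon> * e t"
          by (simp add: algebra_simps)
      next
        show "\<bar>q 0\<bar> + \<bar>r 0\<bar> \<le> B 0"
          using init order_trans[OF _ le_add_same_cancel1[THEN iffD2, OF divide_nonneg_pos[OF D \<kappa>0]]]
          by (simp add: B_def e_def f_def)
      qed (use T in auto)
      also have "B T \<le> J * ((R + A) * f T + D)"
      proof -
        have "0 \<le> H * e T" "0 \<le> 2 / \<mu> * (R * f T)" "0 \<le> A * f T" "0 \<le> 1 / \<kappa>0 * ((R + A) * f T)"
          "0 \<le> (1 + 2 / \<mu>) * D"
          using H e_pos[OF T] \<mu> R A D \<kappa>0 by (simp_all add: f_def)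
        moreover have "J * ((R + A) * f T + D) = (R + H) * f T + D / \<kappa>0 + A * f T + 2 / \<mu> * (R * f T)
            + 1 / \<kappa>0 * ((R + A) * f T) + (1 + 2 / \<mu>) * D"
          using \<mu> by (simp add: J_def H_def algebra_simps)
        ultimately show ?thesis
          by (simp add: B_def)
      qed
      finally show "\<bar>q T\<bar> + \<bar>r T\<bar> \<le> K * J * ((R + A) * exp (- \<kappa> * T) + D)"
        using K by (simp add: f_def mult.assoc)
    qed (use \<kappa> K J in auto)
  qed
qed

lemma has_real_derivative_vec_nth:
  assumes "(x has_vector_derivative D) F"
  shows "((\<lambda>t. x t $ i) has_real_derivative D $ i) F"
  using bounded_linear.has_vector_derivative[OF bounded_linear_vec_nth assms]
  by (simp add: has_real_derivative_iff_has_vector_derivative)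

lemma exp_minus_le_inverse_cube:
  fixes s :: real
  assumes "0 < s"
  shows "exp (- s) \<le> 27 / s ^ 3"
proof -
  have "s / 3 \<le> exp (s / 3)"
    using exp_ge_add_one_self[of "s / 3"] by linarith
  then have "(s / 3) ^ 3 \<le> exp (s / 3) ^ 3"
    using assms by (intro power_mono) auto
  also have "\<dots> = exp s"
    by (simp flip: exp_of_nat_mult)
  finally have "s ^ 3 \<le> 27 * exp s"
    by (simp add: power_divide)
  then show ?thesis
    using assms by (simp add: exp_minus field_simps)
qed

text \<open>
  The trajectory bounds with constants that depend on neither \<open>\<epsilon>\<close> nor the trajectory. The term
  \<open>M / \<epsilon> * exp (- \<mu> * T / \<epsilon>)\<close> in the bound of the plant state is the transient deviation of \<open>x2\<close> from
  \<open>r\<close>; it may be large near \<open>T = 0\<close>, but leaves no lasting effect.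
\<close>

lemma sadrc_closed_loop_bounds:
  fixes f :: "real \<Rightarrow> real \<Rightarrow> real \<Rightarrow> real \<Rightarrow> real"
    and g \<alpha>1 \<alpha>2 \<alpha>3 p \<delta> \<rho> \<beta> :: real
  defines "X \<equiv> \<lambda>x xh. extended_state f x (\<lambda>t. sadrc_control g p \<delta> \<rho> \<beta> (xh t))"
  assumes g: "g \<noteq> 0" and hurwitz: "hurwitz (eso_matrix \<alpha>1 \<alpha>2 \<alpha>3)"
    and p: "0 < p" and \<delta>: "0 < \<delta>" and \<beta>: "0 < \<beta>"
  obtains \<mu> \<kappa> C where "0 < \<mu>" "0 < \<kappa>" "0 < C"
    "\<And>\<epsilon> x xh M \<phi> T.
       \<lbrakk>0 < \<epsilon>; \<epsilon> < 1;
        closed_loop_solution f g \<alpha>1 \<alpha>2 \<alpha>3 p \<delta> \<rho> \<beta> \<epsilon> x xh;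
        rate_bounded_along f x (\<lambda>t. sadrc_control g p \<delta> \<rho> \<beta> (xh t)) \<phi>;
        norm (X x xh 0) + norm (xh 0) \<le> M; 0 \<le> T\<rbrakk>
       \<Longrightarrow> norm (X x xh T - xh T) \<le> C * (M / \<epsilon>\<^sup>2 * exp (- \<mu> * T / \<epsilon>) + \<phi> * \<epsilon>)
         \<and> norm (x T) \<le> C * (M * exp (- \<kappa> * T) + M / \<epsilon> * exp (- \<mu> * T / \<epsilon>) + \<phi> * \<epsilon>)"
proof -
  define d0 where "d0 = min \<delta> (sqrt \<beta>)"
  have d0: "0 < d0"
    using \<delta> \<beta> by (simp add: d0_def)
  show thesis
  proof (rule eso_error_bound[OF hurwitz], goal_cases)
    case (1 \<mu> C0)
    note \<mu> = 1(1) and C0 = 1(2) and observer = 1(3)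
    show thesis
    proof (rule damped_oscillator_peaking_input_bound[OF p d0 \<mu>, where ?d1.0 = \<delta>], goal_cases)
      case (1 \<kappa> K)
      note \<kappa> = 1(1) and K = 1(2) and plant = 1(3)
      have \<alpha>3: "\<alpha>3 \<noteq> 0"
        using hurwitz_eso_matrix_factors[OF hurwitz] by fastforce
      define \<gamma> where "\<gamma> = \<alpha>2 / \<alpha>3"
      define \<Gamma> where "\<Gamma> = 1 + p + (1 + \<delta>) * \<bar>\<gamma>\<bar>"
      define cf where "cf = K * (2 + \<bar>\<gamma>\<bar> + 3 * \<Gamma> * C0)"
      define cD where "cD = (K + 1) * (\<Gamma> * (C0 + 1))"
      define ce where "ce = 3 * \<Gamma> * C0"
      define C where "C = 3 * C0 + cf + cD + ce"
      have \<Gamma>: "0 < \<Gamma>"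
        using p \<delta> by (simp add: \<Gamma>_def add_pos_nonneg)
      then have coeffs: "0 < cf" "0 < cD" "0 < ce"
        using K C0 by (simp_all add: cf_def cD_def ce_def add_pos_pos add_pos_nonneg)
      then have C: "0 < C" "3 * C0 \<le> C" "cf \<le> C" "cD \<le> C" "ce \<le> C"
        using C0 by (simp_all add: C_def)
      show thesis
      proof (rule that[OF \<mu> \<kappa> C(1)])
        fix \<epsilon> M \<phi> T :: real and x :: "real \<Rightarrow> real ^ 2" and xh :: "real \<Rightarrow> real ^ 3"
        assume \<epsilon>: "0 < \<epsilon>" "\<epsilon> < 1"
          and sol: "closed_loop_solution f g \<alpha>1 \<alpha>2 \<alpha>3 p \<delta> \<rho> \<beta> \<epsilon> x xh"
          and rate: "rate_bounded_along f x (\<lambda>t. sadrc_control g p \<delta> \<rho> \<beta> (xh t)) \<phi>"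
          and init: "norm (X x xh 0) + norm (xh 0) \<le> M" and T: "0 \<le> T"
        define d where "d = (\<lambda>t. sadrc_gain \<delta> \<rho> \<beta> (xh t))"
        define F where "F = (\<lambda>t. f (x t $ 1) (x t $ 2) (sadrc_control g p \<delta> \<rho> \<beta> (xh t)) t)"
        have X: "X x xh t $ 1 = x t $ 1" "X x xh t $ 2 = x t $ 2" "X x xh t $ 3 = F t" for t
          by (simp_all add: X_def extended_state_def F_def)
        have input: "g * sadrc_control g p \<delta> \<rho> \<beta> (xh t) = - (p * xh t $ 1 + d t * xh t $ 2 + xh t $ 3)" for t
          using g by (simp add: sadrc_control_def d_def)
        have x_deriv: "((\<lambda>t. x t $ 1) has_real_derivative x t $ 2) (at t within {0..})"
          "((\<lambda>t. x t $ 2) has_real_derivative F t - (p * xh t $ 1 + d t * xh t $ 2 + xh t $ 3)) (at t within {0..})"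
          if t: "0 \<le> t" for t
        proof -
          have D: "(x has_vector_derivative vector [x t $ 2, F t + g * sadrc_control g p \<delta> \<rho> \<beta> (xh t)]) (at t within {0..})"
            using sol t by (simp add: closed_loop_solution_def plant_solution_def Let_def F_def)
          show "((\<lambda>t. x t $ 1) has_real_derivative x t $ 2) (at t within {0..})"
            "((\<lambda>t. x t $ 2) has_real_derivative F t - (p * xh t $ 1 + d t * xh t $ 2 + xh t $ 3)) (at t within {0..})"
            using has_real_derivative_vec_nth[OF D, of 1] has_real_derivative_vec_nth[OF D, of 2]
            by (simp_all add: input algebra_simps)
        qed
        have xh_deriv: "((\<lambda>t. xh t $ 1) has_real_derivative xh t $ 2 + \<alpha>1 / \<epsilon> * (x t $ 1 - xh t $ 1)) (at t within {0..})"
          "((\<lambda>t. xh t $ 2) has_real_derivative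
              \<alpha>2 / \<epsilon>\<^sup>2 * (x t $ 1 - xh t $ 1) - (p * xh t $ 1 + d t * xh t $ 2)) (at t within {0..})"
          "((\<lambda>t. xh t $ 3) has_real_derivative \<alpha>3 / \<epsilon> ^ 3 * (x t $ 1 - xh t $ 1)) (at t within {0..})"
          if t: "0 \<le> t" for t
        proof -
          have D: "(xh has_vector_derivative
              vector [xh t $ 2 + \<alpha>1 / \<epsilon> * (x t $ 1 - xh t $ 1),
                    xh t $ 3 + \<alpha>2 / \<epsilon>\<^sup>2 * (x t $ 1 - xh t $ 1) + g * sadrc_control g p \<delta> \<rho> \<beta> (xh t),
                    \<alpha>3 / \<epsilon> ^ 3 * (x t $ 1 - xh t $ 1)]) (at t within {0..})"
            using sol t by (simp add: closed_loop_solution_def eso_solution_def Let_def)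
          show "((\<lambda>t. xh t $ 1) has_real_derivative xh t $ 2 + \<alpha>1 / \<epsilon> * (x t $ 1 - xh t $ 1)) (at t within {0..})"
            "((\<lambda>t. xh t $ 2) has_real_derivative
              \<alpha>2 / \<epsilon>\<^sup>2 * (x t $ 1 - xh t $ 1) - (p * xh t $ 1 + d t * xh t $ 2)) (at t within {0..})"
            "((\<lambda>t. xh t $ 3) has_real_derivative \<alpha>3 / \<epsilon> ^ 3 * (x t $ 1 - xh t $ 1)) (at t within {0..})"
            using has_real_derivative_vec_nth[OF D, of 1] has_real_derivative_vec_nth[OF D, of 2]
              has_real_derivative_vec_nth[OF D, of 3]
            by (simp_all add: input algebra_simps)
        qed
        have "\<forall>t. \<exists>D. 0 \<le> t \<longrightarrow> (F has_real_derivative D) (at t within {0..}) \<and> \<bar>D\<bar> \<le> \<phi>"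
          using rate by (simp add: rate_bounded_along_def F_def)
        from choice[OF this] obtain h where F_deriv: "\<And>t. 0 \<le> t \<Longrightarrow> (F has_real_derivative h t) (at t within {0..})"
          and h: "\<And>t. 0 \<le> t \<Longrightarrow> \<bar>h t\<bar> \<le> \<phi>"
          by blast
        have \<phi>: "0 \<le> \<phi>"
          using h[of 0] by simp
        define n1 where "n1 = (\<lambda>t. (x t $ 1 - xh t $ 1) / \<epsilon>\<^sup>2)"
        define n2 where "n2 = (\<lambda>t. (x t $ 2 - xh t $ 2) / \<epsilon>)"
        define n3 where "n3 = (\<lambda>t. F t - xh t $ 3)"
        define S where "S = (\<lambda>t. \<bar>n1 t\<bar> + \<bar>n2 t\<bar> + \<bar>n3 t\<bar>)"
        define e where "e = (\<lambda>t. exp (- \<mu> * t / \<epsilon>))"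
        have unscaled: "x t $ 1 - xh t $ 1 = \<epsilon>\<^sup>2 * n1 t" "x t $ 2 - xh t $ 2 = \<epsilon> * n2 t" for t
          using \<epsilon> by (simp_all add: n1_def n2_def)
        have M0: "\<bar>x 0 $ 1 - xh 0 $ 1\<bar> \<le> M" "\<bar>x 0 $ 2 - xh 0 $ 2\<bar> \<le> M" "\<bar>n3 0\<bar> \<le> M"
          "\<bar>x 0 $ 1\<bar> \<le> M" "\<bar>xh 0 $ 2\<bar> \<le> M"
        proof -
          have "\<bar>X x xh 0 $ i\<bar> + \<bar>xh 0 $ i\<bar> \<le> M" for i
            using component_le_norm_cart[of "X x xh 0" i] component_le_norm_cart[of "xh 0" i] init by linarith
          from this[of 1] this[of 2] this[of 3]
          show "\<bar>x 0 $ 1 - xh 0 $ 1\<bar> \<le> M" "\<bar>x 0 $ 2 - xh 0 $ 2\<bar> \<le> M" "\<bar>n3 0\<bar> \<le> M"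
            "\<bar>x 0 $ 1\<bar> \<le> M" "\<bar>xh 0 $ 2\<bar> \<le> M"
            by (auto simp: X n3_def)
        qed
        then have M: "0 \<le> M"
          by linarith
        have S_le: "S t \<le> C0 * (3 * M / \<epsilon>\<^sup>2 * e t + \<phi> * \<epsilon>)" if t: "0 \<le> t" for t
          unfolding S_def e_def
        proof (rule observer[where h = h])
          fix t :: real assume t: "0 \<le> t"
          show "(n1 has_real_derivative (n2 t - \<alpha>1 * n1 t) / \<epsilon>) (at t within {0..})"
            unfolding n1_def n2_def using \<epsilon>
            by (auto intro!: derivative_eq_intros x_deriv[OF t] xh_deriv[OF t] simp: power2_eq_square field_simps)
          show "(n2 has_real_derivative (n3 t - \<alpha>2 * n1 t) / \<epsilon>) (at t within {0..})"
            unfolding n1_def n2_def n3_def using \<epsilon>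
            by (auto intro!: derivative_eq_intros x_deriv[OF t] xh_deriv[OF t] simp: power2_eq_square field_simps)
          show "(n3 has_real_derivative h t - \<alpha>3 * n1 t / \<epsilon>) (at t within {0..})"
            unfolding n1_def n3_def using \<epsilon>
            by (auto intro!: derivative_eq_intros F_deriv[OF t] xh_deriv[OF t] simp: power2_eq_square power3_eq_cube field_simps)
        next
          have "\<bar>n1 0\<bar> \<le> M / \<epsilon>\<^sup>2"
            using M0(1) by (simp add: n1_def divide_right_mono)
          moreover have "\<bar>n2 0\<bar> \<le> M / \<epsilon>\<^sup>2"
          proof -
            have "\<bar>n2 0\<bar> \<le> M / \<epsilon>"
              using M0(2) \<epsilon> by (simp add: n2_def divide_right_mono)
            also have "\<dots> \<le> M / \<epsilon>\<^sup>2"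
              using \<epsilon> M by (intro divide_left_mono) (auto simp: power2_eq_square mult_left_le)
            finally show ?thesis .
          qed
          moreover have "M / 1 \<le> M / \<epsilon>\<^sup>2"
            using \<epsilon> M by (intro divide_left_mono) (auto simp: power_le_one)
          then have "\<bar>n3 0\<bar> \<le> M / \<epsilon>\<^sup>2"
            using M0(3) by simp
          ultimately show "\<bar>n1 0\<bar> + \<bar>n2 0\<bar> + \<bar>n3 0\<bar> \<le> 3 * M / \<epsilon>\<^sup>2"
            by simp
        qed (use \<epsilon> h t in auto)
        have S_nonneg: "0 \<le> S t" for t
          by (simp add: S_def)
        have e_pos: "0 < e t" for t
          by (simp add: e_def)
        have error: "norm (X x xh T - xh T) \<le> C * (M / \<epsilon>\<^sup>2 * e T + \<phi> * \<epsilon>)"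
        proof -
          have "norm (X x xh T - xh T) \<le> \<bar>\<epsilon>\<^sup>2 * n1 T\<bar> + \<bar>\<epsilon> * n2 T\<bar> + \<bar>n3 T\<bar>"
            using norm_le_l1_cart[of "X x xh T - xh T"] by (simp add: sum_3 X unscaled n3_def)
          also have "\<dots> \<le> S T"
            using \<epsilon> by (auto simp: S_def abs_mult power_le_one intro!: add_mono mult_left_le_one_le)
          also have "\<dots> \<le> C0 * (3 * M / \<epsilon>\<^sup>2 * e T + \<phi> * \<epsilon>)"
            by (rule S_le[OF T])
          also have "\<dots> \<le> 3 * C0 * (M / \<epsilon>\<^sup>2 * e T + \<phi> * \<epsilon>)"
            using C0 \<phi> \<epsilon> by (simp add: algebra_simps)
          also have "\<dots> \<le> C * (M / \<epsilon>\<^sup>2 * e T + \<phi> * \<epsilon>)"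
            using C M \<phi> \<epsilon> e_pos[of T] by (intro mult_right_mono) auto
          finally show ?thesis .
        qed
        \<comment> \<open>The combination of \<open>xh2\<close> and \<open>n3\<close> in which the injections \<open>\<alpha>2 n1\<close> and \<open>\<alpha>3 n1 / \<epsilon>\<close> cancel.\<close>
        define r where "r = (\<lambda>t. xh t $ 2 + \<gamma> * \<epsilon> * n3 t)"
        define v1 where "v1 = (\<lambda>t. \<epsilon> * n2 t - \<gamma> * \<epsilon> * n3 t)"
        define v2 where "v2 = (\<lambda>t. p * (\<epsilon>\<^sup>2 * n1 t) + d t * (\<gamma> * \<epsilon> * n3 t) + \<gamma> * \<epsilon> * h t)"
        define A where "A = ce * M"
        define D where "D = \<Gamma> * (C0 + 1) * \<phi> * \<epsilon>"
        have A: "0 \<le> A" and D: "0 \<le> D"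
          using coeffs M \<Gamma> C0 \<phi> \<epsilon> by (simp_all add: A_def D_def)
        have gain: "d0 \<le> d t \<and> d t \<le> \<delta>" for t
        proof -
          have "sqrt \<beta> \<le> sqrt (((xh t $ 3 - \<rho> * xh t $ 1) / xh t $ 2)\<^sup>2 + \<beta>)"
            by simp
          then show ?thesis
            unfolding d_def d0_def sadrc_gain_def by linarith
        qed
        have v_le: "\<bar>v1 t\<bar> \<le> A / \<epsilon> * e t + D \<and> \<bar>v2 t\<bar> \<le> A / \<epsilon> * e t + D" if t: "0 \<le> t" for t
        proof -
          have "\<epsilon> * S t \<le> \<epsilon> * (C0 * (3 * M / \<epsilon>\<^sup>2 * e t + \<phi> * \<epsilon>))"
            using S_le[OF t] \<epsilon> by simp
          also have "\<dots> = C0 * (3 * M / \<epsilon> * e t) + C0 * \<phi> * (\<epsilon> * \<epsilon>)"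
            using \<epsilon> by (simp add: power2_eq_square field_simps)
          also have "\<dots> \<le> C0 * (3 * M / \<epsilon> * e t) + C0 * \<phi> * \<epsilon>"
            using \<epsilon> C0 \<phi> by (intro add_left_mono mult_left_mono) (auto simp: mult_left_le)
          finally have "\<Gamma> * (\<epsilon> * S t + \<phi> * \<epsilon>) \<le> \<Gamma> * (C0 * (3 * M / \<epsilon> * e t) + C0 * \<phi> * \<epsilon> + \<phi> * \<epsilon>)"
            using \<Gamma> by (intro mult_left_mono) auto
          also have "\<dots> = A / \<epsilon> * e t + D"
            using \<epsilon> by (simp add: A_def D_def ce_def field_simps)
          finally have total: "\<Gamma> * (\<epsilon> * S t + \<phi> * \<epsilon>) \<le> A / \<epsilon> * e t + D" .
          have parts: "\<bar>n1 t\<bar> \<le> S t" "\<bar>n2 t\<bar> \<le> S t" "\<bar>n3 t\<bar> \<le> S t"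
            by (simp_all add: S_def)
          define Y where "Y = \<epsilon> * S t + \<phi> * \<epsilon>"
          have Y: "\<epsilon> * \<bar>n1 t\<bar> \<le> Y" "\<epsilon> * \<bar>n2 t\<bar> \<le> Y" "\<epsilon> * \<bar>n3 t\<bar> \<le> Y"
            "\<epsilon> * \<bar>n3 t\<bar> + \<epsilon> * \<bar>h t\<bar> \<le> Y" "0 \<le> Y" "\<epsilon> * \<bar>h t\<bar> \<le> Y"
          proof -
            have "\<epsilon> * \<bar>n1 t\<bar> \<le> \<epsilon> * S t" "\<epsilon> * \<bar>n2 t\<bar> \<le> \<epsilon> * S t" "\<epsilon> * \<bar>n3 t\<bar> \<le> \<epsilon> * S t"
              "\<epsilon> * \<bar>h t\<bar> \<le> \<epsilon> * \<phi>" "0 \<le> \<phi> * \<epsilon>" "0 \<le> \<epsilon> * S t"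
              using parts \<epsilon> h[OF t] \<phi> S_nonneg by simp_all
            then show "\<epsilon> * \<bar>n1 t\<bar> \<le> Y" "\<epsilon> * \<bar>n2 t\<bar> \<le> Y" "\<epsilon> * \<bar>n3 t\<bar> \<le> Y"
              "\<epsilon> * \<bar>n3 t\<bar> + \<epsilon> * \<bar>h t\<bar> \<le> Y" "0 \<le> Y" "\<epsilon> * \<bar>h t\<bar> \<le> Y"
              unfolding Y_def by (simp_all add: mult.commute)
          qed
          have "\<bar>v1 t\<bar> \<le> \<epsilon> * \<bar>n2 t\<bar> + \<bar>\<gamma>\<bar> * (\<epsilon> * \<bar>n3 t\<bar>)"
            using \<epsilon> abs_triangle_ineq4[of "\<epsilon> * n2 t" "\<gamma> * \<epsilon> * n3 t"] by (simp add: v1_def abs_mult mult.assoc)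
          also have "\<dots> \<le> Y + \<bar>\<gamma>\<bar> * Y"
            using Y by (intro add_mono mult_left_mono) auto
          also have "\<dots> \<le> \<Gamma> * Y"
            using p \<delta> Y(5) by (simp add: \<Gamma>_def algebra_simps)
          finally have v1: "\<bar>v1 t\<bar> \<le> \<Gamma> * Y" .
          have "\<bar>v2 t\<bar> \<le> \<bar>p * (\<epsilon>\<^sup>2 * n1 t)\<bar> + \<bar>d t * (\<gamma> * \<epsilon> * n3 t)\<bar> + \<bar>\<gamma> * \<epsilon> * h t\<bar>"
            unfolding v2_def by linarith
          also have "\<dots> = p * (\<epsilon> * (\<epsilon> * \<bar>n1 t\<bar>)) + d t * (\<bar>\<gamma>\<bar> * (\<epsilon> * \<bar>n3 t\<bar>)) + \<bar>\<gamma>\<bar> * (\<epsilon> * \<bar>h t\<bar>)"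
            using p \<epsilon> gain[of t] d0 by (simp add: abs_mult power2_eq_square mult.assoc)
          also have "\<dots> \<le> p * (1 * Y) + \<delta> * (\<bar>\<gamma>\<bar> * Y) + \<bar>\<gamma>\<bar> * Y"
            using p \<epsilon> gain[of t] d0 Y by (intro add_mono mult_mono) auto
          also have "\<dots> \<le> \<Gamma> * Y"
            using Y(5) by (simp add: \<Gamma>_def algebra_simps)
          finally have v2: "\<bar>v2 t\<bar> \<le> \<Gamma> * Y" .
          show ?thesis
            using v1 v2 total unfolding Y_def by linarith
        qed
        have oscillator: "\<bar>x T $ 1\<bar> + \<bar>r T\<bar> \<le> K * (((2 + \<bar>\<gamma>\<bar>) * M + A) * exp (- \<kappa> * T) + D)"
        proof (rule plant[where ?v1.0 = v1 and ?v2.0 = v2 and d = d and \<epsilon> = \<epsilon>])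
          fix t :: real assume t: "0 \<le> t"
          show "((\<lambda>t. x t $ 1) has_real_derivative r t + v1 t) (at t within {0..})"
            using x_deriv(1)[OF t] unscaled(2)[of t] by (simp add: r_def v1_def algebra_simps)
          have r_deriv: "(r has_real_derivative \<alpha>2 / \<epsilon>\<^sup>2 * (x t $ 1 - xh t $ 1) - (p * xh t $ 1 + d t * xh t $ 2)
              + \<gamma> * \<epsilon> * (h t - \<alpha>3 / \<epsilon> ^ 3 * (x t $ 1 - xh t $ 1))) (at t within {0..})"
            unfolding r_def n3_def
            by (auto intro!: derivative_eq_intros xh_deriv[OF t] F_deriv[OF t])
          have cancel: "\<alpha>2 / \<epsilon>\<^sup>2 * z - \<gamma> * \<epsilon> * (\<alpha>3 / \<epsilon> ^ 3 * z) = 0" for z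
            using \<alpha>3 \<epsilon> by (simp add: \<gamma>_def power2_eq_square power3_eq_cube)
          have x1: "x t $ 1 = xh t $ 1 + \<epsilon>\<^sup>2 * n1 t"
            using unscaled(1)[of t] by simp
          have "\<gamma> * \<epsilon> * h t - (p * xh t $ 1 + d t * xh t $ 2) = v2 t - p * x t $ 1 - d t * r t"
            unfolding v2_def r_def x1 by (simp add: algebra_simps)
          then have "\<alpha>2 / \<epsilon>\<^sup>2 * (x t $ 1 - xh t $ 1) - (p * xh t $ 1 + d t * xh t $ 2)
              + \<gamma> * \<epsilon> * (h t - \<alpha>3 / \<epsilon> ^ 3 * (x t $ 1 - xh t $ 1)) = v2 t - p * x t $ 1 - d t * r t"
            using cancel[of "x t $ 1 - xh t $ 1"] unfolding right_diff_distrib[of "\<gamma> * \<epsilon>" "h t"] by linarith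
          then show "(r has_real_derivative v2 t - p * x t $ 1 - d t * r t) (at t within {0..})"
            using r_deriv by simp
          show "\<bar>v1 t\<bar> \<le> A / \<epsilon> * exp (- \<mu> * t / \<epsilon>) + D \<and> \<bar>v2 t\<bar> \<le> A / \<epsilon> * exp (- \<mu> * t / \<epsilon>) + D"
            using v_le[OF t] by (simp add: e_def)
        next
          have "\<bar>r 0\<bar> \<le> \<bar>xh 0 $ 2\<bar> + \<bar>\<gamma>\<bar> * (\<epsilon> * \<bar>n3 0\<bar>)"
            using \<epsilon> abs_triangle_ineq[of "xh 0 $ 2" "\<gamma> * \<epsilon> * n3 0"] by (simp add: r_def abs_mult mult.assoc)
          also have "\<dots> \<le> M + \<bar>\<gamma>\<bar> * (1 * M)"
            using M0 \<epsilon> by (intro add_mono mult_mono) auto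
          finally show "\<bar>x 0 $ 1\<bar> + \<bar>r 0\<bar> \<le> (2 + \<bar>\<gamma>\<bar>) * M"
            using M0 by (simp add: algebra_simps)
        qed (use \<epsilon> A D gain T in auto)
        have "norm (x T) \<le> \<bar>x T $ 1\<bar> + \<bar>x T $ 2\<bar>"
          using norm_le_l1_cart[of "x T"] by (simp add: sum_2)
        also have "\<dots> \<le> \<bar>x T $ 1\<bar> + \<bar>r T\<bar> + \<bar>v1 T\<bar>"
          using unscaled(2)[of T] by (simp add: r_def v1_def)
        also have "\<dots> \<le> K * (((2 + \<bar>\<gamma>\<bar>) * M + A) * exp (- \<kappa> * T) + D) + (A / \<epsilon> * e T + D)"
          using oscillator v_le[OF T] by linarith
        also have "\<dots> = cf * (M * exp (- \<kappa> * T)) + ce * (M / \<epsilon> * e T) + cD * (\<phi> * \<epsilon>)"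
          by (simp add: cf_def cD_def ce_def A_def D_def algebra_simps)
        also have "\<dots> \<le> C * (M * exp (- \<kappa> * T)) + C * (M / \<epsilon> * e T) + C * (\<phi> * \<epsilon>)"
          using C M \<phi> \<epsilon> e_pos[of T] by (intro add_mono mult_right_mono) auto
        finally show "norm (X x xh T - xh T) \<le> C * (M / \<epsilon>\<^sup>2 * exp (- \<mu> * T / \<epsilon>) + \<phi> * \<epsilon>)
             \<and> norm (x T) \<le> C * (M * exp (- \<kappa> * T) + M / \<epsilon> * exp (- \<mu> * T / \<epsilon>) + \<phi> * \<epsilon>)"
          using error by (simp add: e_def distrib_left)
      qed
    qed
  qed
qed

theorem theorem1:
  fixes f :: "real \<Rightarrow> real \<Rightarrow> real \<Rightarrow> real \<Rightarrow> real"
    and g \<alpha>1 \<alpha>2 \<alpha>3 p \<delta> \<rho> \<beta> :: real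
    and x :: "real \<Rightarrow> real \<Rightarrow> real ^ 2"
    and xh :: "real \<Rightarrow> real \<Rightarrow> real ^ 3"
  defines "X \<equiv> \<lambda>\<epsilon>. extended_state f (x \<epsilon>) (\<lambda>t. sadrc_control g p \<delta> \<rho> \<beta> (xh \<epsilon> t))"
  assumes "g \<noteq> 0"
    and "bounded_rate f g \<alpha>1 \<alpha>2 \<alpha>3 p \<delta> \<rho> \<beta>"
    and "\<forall>\<sigma>>0. \<exists>\<delta>f>0. \<forall>x1 x2. \<bar>x1\<bar> + \<bar>x2\<bar> < \<sigma> \<longrightarrow> (\<forall>t\<ge>0. \<forall>u. \<bar>f x1 x2 u t\<bar> < \<delta>f)"
    and "hurwitz (eso_matrix \<alpha>1 \<alpha>2 \<alpha>3)"
    and "p > 0" and "\<delta> > 0" and "0 < \<rho>" and "\<rho> < p" and "2 * (p + \<rho>) < \<beta>"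
    and "\<forall>\<epsilon>\<in>{0<..<1}. closed_loop_solution f g \<alpha>1 \<alpha>2 \<alpha>3 p \<delta> \<rho> \<beta> \<epsilon> (x \<epsilon>) (xh \<epsilon>)"
    and "bounded ((\<lambda>\<epsilon>. x \<epsilon> 0) ` {0<..<1})"
    and "bounded ((\<lambda>\<epsilon>. xh \<epsilon> 0) ` {0<..<1})"
  shows "(\<forall>\<epsilon>\<in>{0<..<1}. \<exists>\<sigma>>0. \<forall>t\<ge>0. norm (X \<epsilon> t) < \<sigma>)
       \<and> ((\<lambda>(\<epsilon>, t). x \<epsilon> t) \<longlongrightarrow> 0) (at_right 0 \<times>\<^sub>F at_top)
       \<and> (\<exists>t0\<ge>0. \<exists>\<sigma>>0. \<forall>\<epsilon>\<in>{0<..<1}. \<forall>t\<ge>t0. norm (X \<epsilon> t - xh \<epsilon> t) \<le> \<sigma> * \<epsilon>)"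
proof -
  obtain \<phi> where rate: "\<And>\<epsilon>. \<epsilon> \<in> {0<..<1} \<Longrightarrow>
      rate_bounded_along f (x \<epsilon>) (\<lambda>t. sadrc_control g p \<delta> \<rho> \<beta> (xh \<epsilon> t)) \<phi>" and \<phi>: "0 < \<phi>"
    using assms(3,11) unfolding bounded_rate_def by blast
  have f_bounded: "\<exists>\<delta>f>0. \<forall>x1 x2. \<bar>x1\<bar> + \<bar>x2\<bar> < \<sigma> \<longrightarrow> (\<forall>t\<ge>0. \<forall>u. \<bar>f x1 x2 u t\<bar> < \<delta>f)" if "0 < \<sigma>" for \<sigma>
    using assms(4) that by blast
  have sol: "closed_loop_solution f g \<alpha>1 \<alpha>2 \<alpha>3 p \<delta> \<rho> \<beta> \<epsilon> (x \<epsilon>) (xh \<epsilon>)" if "\<epsilon> \<in> {0<..<1}" for \<epsilon>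
    using assms(11) that by blast
  have \<beta>: "0 < \<beta>"
    using \<open>p > 0\<close> \<open>0 < \<rho>\<close> order.strict_trans[OF _ \<open>2 * (p + \<rho>) < \<beta>\<close>, of 0] by simp
  have X_le: "norm (X \<epsilon> t) \<le> 2 * norm (x \<epsilon> t) + \<bar>X \<epsilon> t $ 3\<bar>" for \<epsilon> t
  proof -
    have "norm (X \<epsilon> t) \<le> \<bar>x \<epsilon> t $ 1\<bar> + \<bar>x \<epsilon> t $ 2\<bar> + \<bar>X \<epsilon> t $ 3\<bar>"
      using norm_le_l1_cart[of "X \<epsilon> t"] by (simp add: sum_3 X_def extended_state_def)
    then show ?thesis
      using component_le_norm_cart[of "x \<epsilon> t" 1] component_le_norm_cart[of "x \<epsilon> t" 2] by linarith
  qed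
  \<comment> \<open>The constant does not depend on \<open>\<epsilon>\<close>; this makes the initial estimation errors uniformly bounded.\<close>
  have X3_bounded: "\<exists>c>0. \<forall>\<epsilon>. \<forall>t\<ge>0. norm (x \<epsilon> t) \<le> b \<longrightarrow> \<bar>X \<epsilon> t $ 3\<bar> < c" if b: "0 \<le> b" for b
  proof -
    obtain c where c: "0 < c" "\<And>x1 x2 t u. \<lbrakk>\<bar>x1\<bar> + \<bar>x2\<bar> < 2 * b + 1; 0 \<le> t\<rbrakk> \<Longrightarrow> \<bar>f x1 x2 u t\<bar> < c"
      using f_bounded[of "2 * b + 1"] b by auto
    have "\<bar>X \<epsilon> t $ 3\<bar> < c" if "0 \<le> t" "norm (x \<epsilon> t) \<le> b" for \<epsilon> t
    proof -
      have "\<bar>x \<epsilon> t $ 1\<bar> + \<bar>x \<epsilon> t $ 2\<bar> < 2 * b + 1"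
        using component_le_norm_cart[of "x \<epsilon> t" 1] component_le_norm_cart[of "x \<epsilon> t" 2] that by linarith
      then show ?thesis
        using c(2) that(1) by (simp add: X_def extended_state_def)
    qed
    then show ?thesis
      using c(1) by blast
  qed
  obtain M where M: "\<And>\<epsilon>. \<epsilon> \<in> {0<..<1} \<Longrightarrow> norm (X \<epsilon> 0) + norm (xh \<epsilon> 0) \<le> M"
  proof -
    obtain b where b: "0 < b" "\<And>\<epsilon>. \<epsilon> \<in> {0<..<1} \<Longrightarrow> norm (x \<epsilon> 0) \<le> b"
      using assms(12) unfolding bounded_pos by auto
    obtain bh where bh: "\<forall>\<epsilon>\<in>{0<..<1}. norm (xh \<epsilon> 0) \<le> bh"
      using assms(13) by (auto simp: bounded_iff)
    obtain c where c: "\<And>\<epsilon>. norm (x \<epsilon> 0) \<le> b \<Longrightarrow> \<bar>X \<epsilon> 0 $ 3\<bar> < c"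
      using X3_bounded[of b] b(1) by auto
    show thesis
    proof (rule that)
      fix \<epsilon> :: real assume "\<epsilon> \<in> {0<..<1}"
      then show "norm (X \<epsilon> 0) + norm (xh \<epsilon> 0) \<le> 2 * b + c + bh"
        using X_le[of \<epsilon> 0] b(2)[of \<epsilon>] bspec[OF bh, of \<epsilon>] c[of \<epsilon>] by linarith
    qed
  qed
  have "0 \<le> norm (X (1 / 2) 0) + norm (xh (1 / 2) 0)"
    by simp
  also have "\<dots> \<le> M"
    by (rule M) simp
  finally have M_nonneg: "0 \<le> M" .
  obtain \<mu> \<kappa> C where \<mu>: "0 < \<mu>" and \<kappa>: "0 < \<kappa>" and C: "0 < C"
    and bounds: "\<And>\<epsilon> T. \<lbrakk>\<epsilon> \<in> {0<..<1}; 0 \<le> T\<rbrakk>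
       \<Longrightarrow> norm (X \<epsilon> T - xh \<epsilon> T) \<le> C * (M / \<epsilon>\<^sup>2 * exp (- \<mu> * T / \<epsilon>) + \<phi> * \<epsilon>)
         \<and> norm (x \<epsilon> T) \<le> C * (M * exp (- \<kappa> * T) + M / \<epsilon> * exp (- \<mu> * T / \<epsilon>) + \<phi> * \<epsilon>)"
  proof (rule sadrc_closed_loop_bounds[OF \<open>g \<noteq> 0\<close> \<open>hurwitz (eso_matrix \<alpha>1 \<alpha>2 \<alpha>3)\<close>
        \<open>p > 0\<close> \<open>\<delta> > 0\<close> \<beta>, where f = f and \<rho> = \<rho>], goal_cases)
    case (1 \<mu> \<kappa> C)
    show thesis
      by (rule that[OF 1(2-4)], unfold X_def, rule 1(5)) (use sol rate M in \<open>auto simp: X_def\<close>)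
  qed
  define Q where "Q = 27 * M / \<mu> ^ 3 + \<phi>"
  have Q: "0 < Q"
    using M_nonneg \<mu> \<phi> by (simp add: Q_def add_nonneg_pos)
  \<comment> \<open>Three powers of \<open>\<epsilon>\<close> from the exponential outweigh the factor \<open>1 / \<epsilon>\<^sup>2\<close> and leave one.\<close>
  have transient: "M / \<epsilon>\<^sup>2 * exp (- \<mu> * t / \<epsilon>) + \<phi> * \<epsilon> \<le> Q * \<epsilon>" if \<epsilon>: "\<epsilon> \<in> {0<..<1}" and t: "1 \<le> t" for \<epsilon> t
  proof -
    have "exp (- \<mu> * t / \<epsilon>) \<le> exp (- (\<mu> / \<epsilon>))"
      using \<epsilon> t \<mu> by (simp add: divide_right_mono)
    also have "\<dots> \<le> 27 / (\<mu> / \<epsilon>) ^ 3"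
      using \<epsilon> \<mu> by (intro exp_minus_le_inverse_cube) simp
    finally have "M / \<epsilon>\<^sup>2 * exp (- \<mu> * t / \<epsilon>) \<le> M / \<epsilon>\<^sup>2 * (27 / (\<mu> / \<epsilon>) ^ 3)"
      using M_nonneg by (intro mult_left_mono) auto
    also have "\<dots> = 27 * M / \<mu> ^ 3 * \<epsilon>"
      using \<epsilon> \<mu> by (simp add: power2_eq_square power3_eq_cube field_simps)
    finally show ?thesis
      by (simp add: Q_def algebra_simps)
  qed
  have bounded: "\<exists>\<sigma>>0. \<forall>t\<ge>0. norm (X \<epsilon> t) < \<sigma>" if \<epsilon>: "\<epsilon> \<in> {0<..<1}" for \<epsilon>
  proof -
    define b where "b = C * (M * 1 + M / \<epsilon> * 1 + \<phi> * \<epsilon>)"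
    have x_le: "norm (x \<epsilon> t) \<le> b" if t: "0 \<le> t" for t
    proof -
      have "norm (x \<epsilon> t) \<le> C * (M * exp (- \<kappa> * t) + M / \<epsilon> * exp (- \<mu> * t / \<epsilon>) + \<phi> * \<epsilon>)"
        using bounds[OF \<epsilon> t] by blast
      also have "\<dots> \<le> b"
        unfolding b_def using C M_nonneg \<epsilon> \<mu> \<kappa> t \<phi> by (intro mult_left_mono add_mono) auto
      finally show ?thesis .
    qed
    then have "0 \<le> b"
      using norm_ge_zero[of "x \<epsilon> 0"] order_trans by blast
    then obtain c where c: "0 < c" "\<And>t. \<lbrakk>0 \<le> t; norm (x \<epsilon> t) \<le> b\<rbrakk> \<Longrightarrow> \<bar>X \<epsilon> t $ 3\<bar> < c"
      using X3_bounded[of b] by blast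
    have "norm (X \<epsilon> t) < 2 * b + c" if "0 \<le> t" for t
      using X_le[of \<epsilon> t] x_le[OF that] c(2)[OF that] by linarith
    then show ?thesis
      using \<open>0 \<le> b\<close> c(1) by (intro exI[of _ "2 * b + c"]) auto
  qed
  have converges: "((\<lambda>(\<epsilon>, t). x \<epsilon> t) \<longlongrightarrow> 0) (at_right 0 \<times>\<^sub>F at_top)"
  proof (rule Lim_null_comparison)
    have "\<forall>\<^sub>F \<epsilon> in at_right 0. \<epsilon> \<in> {0<..<(1::real)}"
      by (rule eventually_at_right_real) simp
    then have "\<forall>\<^sub>F z in at_right 0 \<times>\<^sub>F at_top. fst z \<in> {0<..<(1::real)} \<and> (1::real) \<le> snd z"
      using eventually_ge_at_top by (rule eventually_prodI)
    then show "\<forall>\<^sub>F z in at_right 0 \<times>\<^sub>F at_top.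
        norm (case z of (\<epsilon>, t) \<Rightarrow> x \<epsilon> t) \<le> C * (M * exp (- \<kappa> * snd z) + Q * fst z)"
    proof (rule eventually_mono)
      fix z :: "real \<times> real" assume z: "fst z \<in> {0<..<1} \<and> 1 \<le> snd z"
      obtain \<epsilon> t where z_eq: "z = (\<epsilon>, t)"
        by (cases z)
      have \<epsilon>: "\<epsilon> \<in> {0<..<1}" and t: "1 \<le> t"
        using z by (simp_all add: z_eq)
      have "M / \<epsilon> \<le> M / \<epsilon>\<^sup>2"
        using \<epsilon> M_nonneg by (intro divide_left_mono) (auto simp: power2_eq_square mult_left_le)
      then have "M / \<epsilon> * exp (- \<mu> * t / \<epsilon>) \<le> M / \<epsilon>\<^sup>2 * exp (- \<mu> * t / \<epsilon>)"
        by (rule mult_right_mono) simp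
      then have "C * (M * exp (- \<kappa> * t) + M / \<epsilon> * exp (- \<mu> * t / \<epsilon>) + \<phi> * \<epsilon>) \<le> C * (M * exp (- \<kappa> * t) + Q * \<epsilon>)"
        using transient[OF \<epsilon> t] C by (intro mult_left_mono) auto
      then show "norm (case z of (\<epsilon>, t) \<Rightarrow> x \<epsilon> t) \<le> C * (M * exp (- \<kappa> * snd z) + Q * fst z)"
        using bounds[OF \<epsilon>, of t] t by (simp add: z_eq)
    qed
    have "LIM t at_top. - \<kappa> * t :> at_bot"
      using \<kappa> by (intro filterlim_tendsto_neg_mult_at_bot[OF tendsto_const _ filterlim_ident]) simp
    then have decay: "((\<lambda>t. exp (- \<kappa> * t)) \<longlongrightarrow> 0) at_top"
      by (rule filterlim_compose[OF exp_at_bot])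
    have "((\<lambda>z. exp (- \<kappa> * snd z)) \<longlongrightarrow> 0) (at_right (0::real) \<times>\<^sub>F at_top)"
      using decay filterlim_snd by (rule filterlim_compose)
    moreover have "(fst \<longlongrightarrow> (0::real)) (at_right 0 \<times>\<^sub>F (at_top :: real filter))"
      using tendsto_ident_at filterlim_fst by (rule filterlim_compose)
    ultimately have "((\<lambda>z. C * (M * exp (- \<kappa> * snd z) + Q * fst z)) \<longlongrightarrow> C * (M * 0 + Q * 0))
        (at_right (0::real) \<times>\<^sub>F at_top)"
      by (intro tendsto_intros)
    then show "((\<lambda>z. C * (M * exp (- \<kappa> * snd z) + Q * fst z)) \<longlongrightarrow> 0) (at_right (0::real) \<times>\<^sub>F at_top)"
      by simp
  qed
  have "norm (X \<epsilon> t - xh \<epsilon> t) \<le> C * Q * \<epsilon>" if \<epsilon>: "\<epsilon> \<in> {0<..<1}" and t: "1 \<le> t" for \<epsilon> t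
  proof -
    have "norm (X \<epsilon> t - xh \<epsilon> t) \<le> C * (M / \<epsilon>\<^sup>2 * exp (- \<mu> * t / \<epsilon>) + \<phi> * \<epsilon>)"
      using bounds[OF \<epsilon>, of t] t by simp
    also have "\<dots> \<le> C * (Q * \<epsilon>)"
      using transient[OF \<epsilon> t] C by (intro mult_left_mono) auto
    finally show ?thesis
      by (simp add: mult.assoc)
  qed
  then have "\<exists>t0\<ge>0. \<exists>\<sigma>>0. \<forall>\<epsilon>\<in>{0<..<1}. \<forall>t\<ge>t0. norm (X \<epsilon> t - xh \<epsilon> t) \<le> \<sigma> * \<epsilon>"
    using C Q by (intro exI[of _ 1] conjI exI[of _ "C * Q"] ballI allI impI) auto
  then show ?thesis
    using bounded converges by blast
qed

end
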